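(* Let $p_1=2<p_2=3<\cdots$ denote the primes in increasing order, let $l_j:=p_{j+1}^2-p_j^2$ and $\tilde\pi_j := l_j\prod_{i=1}^{j}\left(1-\frac{1}{p_i}\right)$ for $j\ge1$. For real $x\ge 4$, let $k$ be the integer with $p_k^2\le x<p_{k+1}^2$ and define $$\tilde\pi(x) := \sum_{j=1}^{k-1}\tilde\pi_j + \frac{x-p_k^2}{l_k}\,\tilde\pi_k.$$ Then, as $x\to\infty$, $$\tilde\pi(x)\sim 2e^{-\gamma}\,\mathrm{li}(x),$$ where $\gamma$ is the Euler--Mascheroni constant and $\mathrm{li}(x)=\int_2^x\frac{dt}{\log t}$.
   Context: $\tilde\pi(x)$ is the paper's probabilistic prime counting function, obtained by summing the heuristic expected prime counts $\tilde\pi_j$ of the intervals $s_j=\{p_j^2,\dots,p_{j+1}^2-1\}$ (each of length $l_j$), with a linear interpolation on the last partial interval. The notation $f\sim g$ means $f/g\to1$. *)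

theory Defs
  imports "HOL-Analysis.Analysis" "HOL-Computational_Algebra.Primes"
    "HOL-Library.Landau_Symbols"
begin

text \<open>The j-th prime, 1-indexed: p 1 = 2, p 2 = 3, ...\<close>
definition pr :: "nat \<Rightarrow> nat" where
  "pr j = enumerate {q::nat. prime q} (j - 1)"

definition ell :: "nat \<Rightarrow> real" where
  "ell j = real (pr (j + 1))^2 - real (pr j)^2"

definition pitilde_j :: "nat \<Rightarrow> real" where
  "pitilde_j j = ell j * (\<Prod>i=1..j. (1 - 1 / real (pr i)))"

text \<open>For x >= 4, the unique k >= 1 with p_k^2 <= x < p_(k+1)^2.\<close>
definition kidx :: "real \<Rightarrow> nat" where
  "kidx x = (THE k. 1 \<le> k \<and> real (pr k)^2 \<le> x \<and> x < real (pr (k + 1))^2)"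

definition pitilde :: "real \<Rightarrow> real" where
  "pitilde x = (let k = kidx x in
     (\<Sum>j=1..k-1. pitilde_j j) + (x - real (pr k)^2) / ell k * pitilde_j k)"

definition li :: "real \<Rightarrow> real" where
  "li x = integral {2..x} (\<lambda>t. 1 / ln t)"

end

theory Submission
  imports Defs "HOL-Real_Asymp.Real_Asymp"
begin

text \<open>
  For \<open>t\<close> between the squares of consecutive primes, the slope of \<open>pitilde\<close> at \<open>t\<close> is the product
  of \<open>1 - 1/p\<close> over the primes \<open>p \<le> sqrt t\<close>, so \<open>pitilde x\<close> is the integral of this product over
  \<open>{4..x}\<close>. By Mertens' third theorem the product is asymptotic to
  \<open>exp (- euler_mascheroni) / ln (sqrt t)\<close>, which is \<open>2 * exp (- euler_mascheroni) / ln t\<close>, and this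
  can be integrated because \<open>li\<close> diverges.

  For Mertens' third theorem, the sum of \<open>- ln (1 - 1/p)\<close> over \<open>p \<le> N\<close> minus \<open>ln (ln N)\<close> converges
  to some \<open>c\<close>, by Mertens' first theorem and the Dirichlet test. Weighting the terms by \<open>p powr - t\<close>
  and letting \<open>t\<close> tend to \<open>0\<close> determines \<open>c\<close>: the weighted sum plus \<open>ln t\<close> tends to \<open>0\<close> by the Euler
  product for zeta at \<open>1 + t\<close>, and to \<open>c - euler_mascheroni\<close> by Abel's theorem, applied to the
  difference between the sums over \<open>exp m < p \<le> exp (m + 1)\<close> and the harmonic series.
\<close>

section \<open>Mertens' first theorem\<close>

lemma prod_primes_dvd:
  fixes k :: nat
  assumes "finite A" "\<And>p. p \<in> A \<Longrightarrow> prime p \<and> p dvd k"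
  shows "\<Prod>A dvd k"
  using assms
proof (induction A rule: finite_induct)
  case (insert p A)
  have "coprime p (\<Prod>A)"
    using insert by (intro prod_coprime_right) (metis insertCI primes_coprime)
  then show ?case
    using insert by (simp add: divides_mult)
qed auto

text \<open>The coefficients at \<open>m\<close> and \<open>m + 1\<close> are equal by symmetry, and
  together they are at most the whole row sum \<open>2 * 4 ^ m\<close>.\<close>

lemma central_binomial_le: "(2 * m + 1) choose m \<le> 4 ^ m"
proof -
  have "2 * ((2 * m + 1) choose m) = (\<Sum>k\<in>{m, m + 1}. (2 * m + 1) choose k)"
    using binomial_symmetric[of m "2 * m + 1"] by simp
  also have "\<dots> \<le> (\<Sum>k\<le>2 * m + 1. (2 * m + 1) choose k)"
    by (intro sum_mono2) auto
  also have "\<dots> = 2 * 4 ^ m"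
    by (subst choose_row_sum) (simp add: power_mult)
  finally show ?thesis by simp
qed

text \<open>Erdos's induction. An even \<open>n > 2\<close> is not prime, so nothing is gained from
  \<open>n - 1\<close> to \<open>n\<close>. For \<open>n = 2 * m + 1\<close> the primes above
  \<open>m + 1\<close> all divide the central binomial coefficient, which is at most
  \<open>4 ^ m\<close>, and the primes up to \<open>m + 1\<close> are covered by induction.\<close>

lemma primorial_le: "\<Prod>{p::nat. prime p \<and> p \<le> n} \<le> 4 ^ n"
proof (induction n rule: less_induct)
  case (less n)
  consider "n \<le> 2" | "n > 2" "even n" | m where "m > 0" "n = 2 * m + 1"
    by (metis One_nat_def add_0 bot_nat_0.not_eq_extremum linorder_not_le mult_0_right oddE one_le_numeral)
  then show ?case
  proof cases
    case 1
    have "{p::nat. prime p \<and> p \<le> n} = (if n = 2 then {2} else {})"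
      using 1 by (auto dest: prime_ge_2_nat)
    then show ?thesis by auto
  next
    case 2
    have "\<not> prime n"
      using 2 prime_odd_nat by blast
    then have "{p::nat. prime p \<and> p \<le> n} = {p. prime p \<and> p \<le> n - 1}"
      using 2 by (auto simp: le_less)
    also have "\<Prod>\<dots> \<le> 4 ^ (n - 1)"
      using less 2 by simp
    also have "\<dots> \<le> 4 ^ n" by (intro power_increasing) auto
    finally show ?thesis .
  next
    case 3
    define A where "A = {p. prime p \<and> m + 1 < p \<and> p \<le> 2 * m + 1}"
    have fin: "finite A" by (auto simp: A_def)
    have "\<Prod>A dvd ((2 * m + 1) choose m)"
    proof (rule prod_primes_dvd[OF fin])
      fix p assume p: "p \<in> A"
      then have "prime p" by (simp add: A_def)
      \<comment> \<open>This product is \<open>fact (2 * m + 1)\<close>. Since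
        \<open>p > m + 1\<close>, the prime divides neither factorial and must divide the
        coefficient.\<close>
      have "p dvd fact m * fact (m + 1) * ((2 * m + 1) choose m)"
        using p binomial_fact_lemma[of m "2 * m + 1"] prime_dvd_fact_iff[OF \<open>prime p\<close>, of "2 * m + 1"]
        by (simp add: A_def)
      moreover have "\<not> p dvd fact m" "\<not> p dvd fact (m + 1)"
        using p prime_dvd_fact_iff[OF \<open>prime p\<close>, of "m"] prime_dvd_fact_iff[OF \<open>prime p\<close>, of "m + 1"]
        by (simp_all add: A_def del: fact_Suc)
      ultimately show "prime p \<and> p dvd ((2 * m + 1) choose m)"
        using \<open>prime p\<close> prime_dvd_mult_iff by blast
    qed
    then have A: "\<Prod>A \<le> 4 ^ m"
      using central_binomial_le[of m] by (auto dest!: dvd_imp_le)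
    have "{p::nat. prime p \<and> p \<le> n} = {p. prime p \<and> p \<le> m + 1} \<union> A"
      using 3 by (auto simp: A_def)
    moreover have "{p. prime p \<and> p \<le> m + 1} \<inter> A = {}"
      by (auto simp: A_def)
    ultimately have "\<Prod>{p::nat. prime p \<and> p \<le> n} = \<Prod>{p::nat. prime p \<and> p \<le> m + 1} * \<Prod>A"
      using fin by (simp add: prod.union_disjoint)
    also have "\<dots> \<le> 4 ^ (m + 1) * 4 ^ m"
      using 3 by (intro mult_le_mono A less) auto
    also have "\<dots> = 4 ^ n"
      using 3 by (simp flip: power_add add: mult_2)
    finally show ?thesis .
  qed
qed

text \<open>Chebyshev's bound for theta. It pays for rounding \<open>n / p\<close> to an integer in
  the upper half of Mertens' first theorem.\<close>

lemma sum_ln_primes_le: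
  fixes n :: nat
  shows "(\<Sum>p | prime p \<and> p \<le> n. ln (real p)) \<le> n * ln 4"
proof -
  have "(\<Sum>p | prime p \<and> p \<le> n. ln (real p)) = ln (real (\<Prod>{p. prime p \<and> p \<le> n}))"
    unfolding of_nat_prod by (subst ln_prod) (auto dest: prime_gt_0_nat)
  also have "\<dots> \<le> ln (4 ^ n)"
  proof (subst ln_le_cancel_iff)
    show "0 < real (\<Prod>{p. prime p \<and> p \<le> n})"
      by (auto intro!: prod_pos dest: prime_gt_0_nat)
    show "real (\<Prod>{p. prime p \<and> p \<le> n}) \<le> 4 ^ n"
      using primorial_le[of n] by (metis of_nat_le_iff of_nat_numeral of_nat_power)
  qed auto
  finally show ?thesis by (simp add: ln_realpow)
qed

section \<open>Legendre's formula for the prime factorisation of \<open>fact N\<close>\<close>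

lemma multiplicity_eq_card:
  assumes "prime p" "0 < n" "n \<le> (N::nat)"
  shows "multiplicity p n = card {k\<in>{1..N}. p ^ k dvd n}"
proof -
  \<comment> \<open>Exponents never exceed \<open>N\<close>, so one range \<open>{1..N}\<close>
    serves every \<open>n\<close> and the sums over \<open>n\<close> and \<open>k\<close> can later
    be swapped.\<close>
  have "k \<le> N" if "p ^ k dvd n" for k
  proof -
    have "k < 2 ^ k" by simp
    also have "\<dots> \<le> p ^ k" using assms prime_ge_2_nat by (intro power_mono) auto
    also have "\<dots> \<le> n" using that assms by (intro dvd_imp_le)
    finally show ?thesis using assms by simp
  qed
  moreover have "p ^ k dvd n \<longleftrightarrow> k \<le> multiplicity p n" for k
    using assms by (intro power_dvd_iff_le_multiplicity) auto
  ultimately have "{k\<in>{1..N}. p ^ k dvd n} = {1..multiplicity p n}"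
    by auto
  then show ?thesis by simp
qed

lemma card_multiples: "0 < d \<Longrightarrow> card {n\<in>{1..N}. d dvd n} = N div (d::nat)"
proof -
  assume "0 < d"
  then have "{n\<in>{1..N}. d dvd n} = (\<lambda>k. d * k) ` {1..N div d}"
    by (auto simp: dvd_def less_eq_div_iff_mult_less_eq mult.commute image_iff)
  moreover have "inj_on (\<lambda>k. d * k) {1..N div d}"
    using \<open>0 < d\<close> by (auto simp: inj_on_def)
  ultimately show ?thesis by (simp add: card_image)
qed

text \<open>Each \<open>ln n\<close> is spread over the prime powers dividing \<open>n\<close>.
  After interchanging the sums, the multiples of \<open>p ^ k\<close> up to \<open>N\<close> are
  counted; terms with \<open>p ^ k > N\<close> contribute 0.\<close>

lemma ln_fact_eq_sum_primes:
  "ln (fact N :: real) = (\<Sum>p | prime p \<and> p \<le> N. ln (real p) * (\<Sum>k=1..N. real (N div p ^ k)))"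
proof -
  define P where "P = {p::nat. prime p \<and> p \<le> N}"
  have fin: "finite P" by (auto simp: P_def)
  have ln_n: "ln (real n) = (\<Sum>p\<in>P. \<Sum>k=1..N. if p ^ k dvd n then ln (real p) else 0)"
    if n: "n \<in> {1..N}" for n
  proof -
    have "n = (\<Prod>p\<in>prime_factors n. p ^ multiplicity p n)"
      using n by (intro prime_factorization_nat) auto
    also have "\<dots> = (\<Prod>p\<in>P. p ^ multiplicity p n)"
    proof (intro prod.mono_neutral_left fin)
      show "prime_factors n \<subseteq> P"
        using n by (auto simp: P_def prime_factors_dvd dest!: dvd_imp_le)
      show "\<forall>i\<in>P - prime_factors n. i ^ multiplicity i n = 1"
        by (auto simp: P_def prime_factors_multiplicity)
    qed
    finally have "ln (real n) = ln (\<Prod>p\<in>P. real p ^ multiplicity p n)"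
      by (metis (mono_tags, lifting) of_nat_power of_nat_prod prod.cong)
    also have "\<dots> = (\<Sum>p\<in>P. real (multiplicity p n) * ln (real p))"
      using fin by (subst ln_prod) (auto simp: P_def ln_realpow dest: prime_gt_0_nat)
    also have "\<dots> = (\<Sum>p\<in>P. \<Sum>k=1..N. if p ^ k dvd n then ln (real p) else 0)"
    proof (intro sum.cong refl)
      fix p assume "p \<in> P"
      then have "multiplicity p n = card {k\<in>{1..N}. p ^ k dvd n}"
        using n by (intro multiplicity_eq_card) (auto simp: P_def)
      then show "real (multiplicity p n) * ln (real p) = (\<Sum>k=1..N. if p ^ k dvd n then ln (real p) else 0)"
        by (simp flip: sum.inter_filter)
    qed
    finally show ?thesis .
  qed
  have "ln (fact N :: real) = (\<Sum>n=1..N. ln (real n))"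
    unfolding fact_prod of_nat_prod by (subst ln_prod) auto
  also have "\<dots> = (\<Sum>n=1..N. \<Sum>p\<in>P. \<Sum>k=1..N. if p ^ k dvd n then ln (real p) else 0)"
    by (intro sum.cong refl ln_n)
  also have "\<dots> = (\<Sum>p\<in>P. \<Sum>n=1..N. \<Sum>k=1..N. if p ^ k dvd n then ln (real p) else 0)"
    by (rule sum.swap)
  also have "\<dots> = (\<Sum>p\<in>P. \<Sum>k=1..N. \<Sum>n=1..N. if p ^ k dvd n then ln (real p) else 0)"
    by (intro sum.cong refl sum.swap)
  also have "\<dots> = (\<Sum>p\<in>P. \<Sum>k=1..N. ln (real p) * real (N div p ^ k))"
  proof (intro sum.cong refl)
    fix p k assume "p \<in> P"
    then have "0 < p ^ k" by (auto simp: P_def dest: prime_gt_0_nat)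
    then show "(\<Sum>n=1..N. if p ^ k dvd n then ln (real p) else 0) = ln (real p) * real (N div p ^ k)"
      by (simp flip: sum.inter_filter add: card_multiples[simplified])
  qed
  finally show ?thesis
    by (simp add: P_def sum_distrib_left)
qed


text \<open>A weak Stirling bound. The induction step rests on
  \<open>n * ln (1 + 1 / n) <= 1\<close>.\<close>

lemma ln_fact_ge: "n * ln n - n \<le> ln (fact n :: real)"
proof (induction n)
  case (Suc n)
  show ?case
  proof (cases "n = 0")
    case False
    have "ln (1 + 1 / real n) \<le> 1 / n"
      using ln_add_one_self_le_self[of "1 / real n"] by simp
    moreover have "ln (real (Suc n)) = ln n + ln (1 + 1 / real n)"
    proof -
      have "real (Suc n) = n * (1 + 1 / real n)"
        using False by (simp add: field_simps)
      then show ?thesis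
        using False by (metis add_pos_pos divide_pos_pos ln_mult_pos not_gr_zero of_nat_0_less_iff zero_less_one)
    qed
    ultimately have "n * ln (real (Suc n)) \<le> n * ln n + 1"
      using False by (simp add: field_simps)
    moreover have "ln (fact (Suc n) :: real) = ln (real (Suc n)) + ln (fact n)"
      unfolding fact_Suc of_nat_mult by (subst ln_mult) auto
    moreover have "real (Suc n) * ln (real (Suc n)) = n * ln (real (Suc n)) + ln (real (Suc n))"
      by (simp add: algebra_simps)
    ultimately show ?thesis using Suc by linarith
  qed auto
qed auto

text \<open>In Legendre's formula the term \<open>k = 1\<close> alone gives \<open>n / p\<close> up
  to an error of 1. The errors add up to the sum of \<open>ln p\<close>, which Chebyshev's bound
  controls, and \<open>fact n <= n ^ n\<close> bounds the rest.\<close>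

lemma mertens_first_upper:
  fixes n :: nat
  assumes "n \<ge> 1"
  shows "(\<Sum>p | prime p \<and> p \<le> n. ln p / real p) \<le> ln n + ln 4"
proof -
  let ?P = "{p. prime p \<and> p \<le> n}"
  have "n * (\<Sum>p\<in>?P. ln p / real p) = (\<Sum>p\<in>?P. ln (real p) * (real n / real p))"
    by (simp add: sum_distrib_left mult.commute)
  also have "\<dots> \<le> (\<Sum>p\<in>?P. ln (real p) * ((\<Sum>k=1..n. real (n div p ^ k)) + 1))"
  proof (intro sum_mono mult_left_mono)
    fix p assume "p \<in> ?P"
    then have p: "p \<ge> 2" by (auto dest: prime_ge_2_nat)
    then show "0 \<le> ln (real p)" by simp
    have "real n / real p \<le> real (n div p) + 1"
      using p floor_divide_of_nat_eq[of n p, where 'a = real] by linarith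
    also have "real (n div p) \<le> (\<Sum>k=1..n. real (n div p ^ k))"
      using assms member_le_sum[of 1 "{1..n}" "\<lambda>k. real (n div p ^ k)"] by simp
    finally show "real n / real p \<le> (\<Sum>k=1..n. real (n div p ^ k)) + 1" by simp
  qed
  also have "\<dots> = ln (fact n :: real) + (\<Sum>p\<in>?P. ln (real p))"
    by (simp add: ln_fact_eq_sum_primes sum.distrib distrib_left)
  also have "\<dots> \<le> n * ln n + n * ln 4"
  proof (intro add_mono sum_ln_primes_le)
    have "(fact n :: real) \<le> real n ^ n"
      using fact_le_power[of n, where 'a = real] by simp
    then show "ln (fact n) \<le> n * ln n"
      using assms by (metis fact_gt_zero ln_mono ln_realpow of_nat_0_less_iff zero_less_one order_less_le_trans)
  qed
  finally have "n * (\<Sum>p\<in>?P. ln p / real p) \<le> n * (ln n + ln 4)"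
    by (simp add: distrib_left)
  then show ?thesis using assms by simp
qed

lemma sum_geometric_le:
  assumes "x > (1::real)"
  shows "(\<Sum>k=1..n. 1 / x ^ k) \<le> 1 / (x - 1)"
proof -
  have "(x - 1) * (\<Sum>k=1..n. 1 / x ^ k) = 1 - 1 / x ^ n"
  proof (induction n)
    case (Suc n)
    then show ?case
      using assms by (simp add: distrib_left) (simp add: field_simps)
  qed auto
  then have "(\<Sum>k=1..n. 1 / x ^ k) = (1 - 1 / x ^ n) / (x - 1)"
    using assms by (simp add: field_simps)
  also have "\<dots> \<le> 1 / (x - 1)"
    using assms by (intro divide_right_mono) auto
  finally show ?thesis .
qed

text \<open>From \<open>ln n <= 2 * sqrt n\<close> and \<open>n - 1 >= n / 2\<close>. The right-hand
  side is summable over all integers, which bounds the contribution of higher prime powers.\<close>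

lemma ln_div_sq_le:
  assumes "n \<ge> 2"
  shows "ln (real n) / (real n * (real n - 1)) \<le> 4 * real n powr (-3/2)"
proof -
  have "ln (real n) = 2 * ln (sqrt (real n))"
    using assms by (simp add: ln_sqrt)
  also have "\<dots> \<le> 2 * sqrt (real n)"
    using assms ln_le_minus_one[of "sqrt (real n)"] by simp
  finally have "ln (real n) / (real n * (real n - 1)) \<le> 2 * sqrt (real n) / (real n * (real n / 2))"
    using assms by (intro frac_le mult_left_mono mult_pos_pos) auto
  also have "\<dots> = 4 * (real n powr (1/2) / real n powr 2)"
    using assms by (simp add: powr_half_sqrt power2_eq_square[symmetric])
  also have "\<dots> = 4 * real n powr (-3/2)"
    by (simp only: powr_diff[symmetric]) simp
  finally show ?thesis .
qed

text \<open>Dropping the rounding in Legendre's formula and summing the geometric series gives at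
  most \<open>n / (p - 1)\<close> for each prime. This is \<open>n / p\<close> plus
  \<open>n / (p * (p - 1))\<close>, and the second part has a bounded sum after weighting by
  \<open>ln p / n\<close>.\<close>

lemma mertens_first_lower:
  "\<exists>K. \<forall>n\<ge>1. ln (real n) - K \<le> (\<Sum>p | prime p \<and> p \<le> n. ln p / real p)"
proof -
  define K where "K = (\<Sum>n. 4 * real n powr (-3/2))"
  have sm: "summable (\<lambda>n. 4 * real n powr (-3/2))"
    by (intro summable_mult) (simp add: summable_real_powr_iff)
  have "ln (real n) - (K + 1) \<le> (\<Sum>p | prime p \<and> p \<le> n. ln p / real p)" if "n \<ge> 1" for n
  proof -
    let ?P = "{p. prime p \<and> p \<le> n}"
    have "n * ln n - n \<le> ln (fact n :: real)" by (rule ln_fact_ge)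
    also have "\<dots> = (\<Sum>p\<in>?P. ln (real p) * (\<Sum>k=1..n. real (n div p ^ k)))"
      by (rule ln_fact_eq_sum_primes)
    also have "\<dots> \<le> (\<Sum>p\<in>?P. ln (real p) * (n * (1 / (real p - 1))))"
    proof (intro sum_mono mult_left_mono)
      fix p assume "p \<in> ?P"
      then have p: "p \<ge> 2" by (auto dest: prime_ge_2_nat)
      then show "0 \<le> ln (real p)" by simp
      have "(\<Sum>k=1..n. real (n div p ^ k)) \<le> (\<Sum>k=1..n. n * (1 / real p ^ k))"
        using of_nat_div_le_of_nat[of n "p ^ _", where 'a = real] by (intro sum_mono) simp
      also have "\<dots> = n * (\<Sum>k=1..n. 1 / real p ^ k)"
        by (simp add: sum_distrib_left)
      also have "\<dots> \<le> n * (1 / (real p - 1))"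
        using p by (intro mult_left_mono sum_geometric_le) auto
      finally show "(\<Sum>k=1..n. real (n div p ^ k)) \<le> n * (1 / (real p - 1))" .
    qed
    also have "\<dots> = n * (\<Sum>p\<in>?P. ln p / real p + ln p / (real p * (real p - 1)))"
      unfolding sum_distrib_left
    proof (intro sum.cong refl)
      fix p assume "p \<in> ?P"
      then have p: "real p \<ge> 2" by (auto dest: prime_ge_2_nat)
      then show "ln (real p) * (n * (1 / (real p - 1))) =
          n * (ln p / real p + ln p / (real p * (real p - 1)))"
        by (simp add: field_simps)
    qed
    finally have "n * (ln n - 1) \<le> n * (\<Sum>p\<in>?P. ln p / real p + ln p / (real p * (real p - 1)))"
      by (simp add: right_diff_distrib)
    then have "ln n - 1 \<le> (\<Sum>p\<in>?P. ln p / real p) + (\<Sum>p\<in>?P. ln p / (real p * (real p - 1)))"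
      using that by (simp add: sum.distrib)
    also have "(\<Sum>p\<in>?P. ln p / (real p * (real p - 1))) \<le> (\<Sum>p\<in>?P. 4 * real p powr (-3/2))"
      by (intro sum_mono ln_div_sq_le) (auto dest: prime_ge_2_nat)
    also have "\<dots> \<le> K"
      unfolding K_def using sm by (intro sum_le_suminf) auto
    finally show ?thesis by simp
  qed
  then show ?thesis by blast
qed

section \<open>Mertens' second theorem\<close>

text \<open>Summation by parts: the series splits into \<open>R (Suc n) * (g n - g (Suc n))\<close>,
  dominated by a telescoping series, and the differences of \<open>R n * g n\<close>, which tends to
  0.\<close>

lemma dirichlet_test:
  fixes R g :: "nat \<Rightarrow> real"
  assumes R: "\<And>n. \<bar>R n\<bar> \<le> K" and g: "decseq g" "g \<longlonglongrightarrow> 0"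
  shows "summable (\<lambda>n. (R (Suc n) - R n) * g n)"
proof -
  have "summable (\<lambda>n. K * (g n - g (Suc n)))"
    using telescope_summable'[OF g(2)] by (rule summable_mult)
  then have "summable (\<lambda>n. R (Suc n) * (g n - g (Suc n)))"
  proof (rule summable_comparison_test')
    fix n
    show "norm (R (Suc n) * (g n - g (Suc n))) \<le> K * (g n - g (Suc n))"
      using R decseqD[OF g(1), of n "Suc n"] by (auto simp: abs_mult intro: mult_right_mono)
  qed
  moreover have "(\<lambda>n. R n * g n) \<longlonglongrightarrow> 0"
    using R by (intro tendsto_0_le[OF g(2), where K = K] always_eventually)
      (auto simp: abs_mult mult.commute intro: mult_right_mono)
  then have "summable (\<lambda>n. R (Suc n) * g (Suc n) - R n * g n)"
    by (rule telescope_summable)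
  ultimately have "summable (\<lambda>n. R (Suc n) * (g n - g (Suc n)) + (R (Suc n) * g (Suc n) - R n * g n))"
    by (rule summable_add)
  then show ?thesis by (simp add: algebra_simps)
qed

text \<open>Partial summation with \<open>1 / p = (ln p / p) * (1 / ln p)\<close>. By Mertens' first
  theorem the sum of \<open>ln p / p\<close> is \<open>ln n\<close> plus a bounded \<open>R\<close>.
  The part from \<open>R\<close> converges by the Dirichlet test, and the part from
  \<open>ln n\<close> differs from the increments of \<open>ln (ln n)\<close> by a summable
  error.\<close>

lemma mertens_second:
  "\<exists>M. (\<lambda>n. (\<Sum>p | prime p \<and> p \<le> n. 1 / real p) - ln (ln (real n))) \<longlonglongrightarrow> M"
proof -
  define b where "b n = (\<Sum>p | prime p \<and> p \<le> n. ln p / real p)" for n :: nat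
  define a where "a n = (\<Sum>p | prime p \<and> p \<le> n. 1 / real p)" for n :: nat
  define R where "R n = b (n + 2) - ln (real (n + 2))" for n
  \<comment> \<open>The shift by 2 keeps all logarithms positive. Passing from \<open>n + 2\<close>
    to \<open>n + 3\<close> adds the integer \<open>n + 3\<close>, so its weight is
    \<open>g n\<close>, which is also \<open>h (Suc n)\<close>.\<close>
  define g where "g n = 1 / ln (real (n + 3))" for n
  define h where "h n = 1 / ln (real (n + 2))" for n
  define E where "E n = a (n + 2) - ln (ln (real (n + 2)))" for n
  have primes_Suc: "{p. prime p \<and> p \<le> Suc n} = (if prime (Suc n) then insert (Suc n) else id) {p. prime p \<and> p \<le> n}" for n
    by (auto simp: le_Suc_eq)
  have b_Suc: "b (Suc n) = b n + (if prime (Suc n) then ln (Suc n) / Suc n else 0)" for n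
    unfolding b_def primes_Suc by simp
  have a_Suc: "a (Suc n) = a n + (if prime (Suc n) then 1 / Suc n else 0)" for n
    unfolding a_def primes_Suc by simp
  obtain K where K: "\<And>n. n \<ge> 1 \<Longrightarrow> ln (real n) - K \<le> b n"
    using mertens_first_lower unfolding b_def by blast
  have "summable (\<lambda>n. (R (Suc n) - R n) * g n)"
  proof (rule dirichlet_test)
    have "0 \<le> ln (4::real)" by simp
    then show "\<bar>R n\<bar> \<le> \<bar>K\<bar> + ln 4" for n
      using K[of "n + 2"] mertens_first_upper[of "n + 2"] unfolding R_def b_def[symmetric]
      by linarith
    show "decseq g"
      unfolding g_def decseq_def by (intro allI impI frac_le) auto
    show "g \<longlonglongrightarrow> 0"
      unfolding g_def by real_asymp
  qed
  moreover have "summable (\<lambda>n. (ln (real (n + 3)) - ln (real (n + 2))) * g n - (ln (ln (real (n + 3))) - ln (ln (real (n + 2)))))"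
  proof (rule summable_comparison_test')
    have "h \<longlonglongrightarrow> 0" unfolding h_def by real_asymp
    then show "summable (\<lambda>n. h n - h (Suc n))" by (rule telescope_summable')
    fix n :: nat
    define x y where "x = ln (real (n + 2))" and "y = ln (real (n + 3))"
    have xy: "0 < x" "x \<le> y" by (auto simp: x_def y_def)
    \<comment> \<open>Both \<open>(y - x) / y\<close> and \<open>ln y - ln x\<close> lie in the
      interval from \<open>1 - x / y\<close> to \<open>y / x - 1\<close>. Its length is
      \<open>(y - x) * (1 / x - 1 / y)\<close>, and \<open>y - x <= 1\<close> makes this at most a
      telescoping difference.\<close>
    have "ln (y / x) \<le> y / x - 1" "ln (x / y) \<le> x / y - 1"
      using xy by (auto intro!: ln_le_minus_one)
    then have 1: "ln y - ln x \<le> y / x - 1" "1 - x / y \<le> ln y - ln x"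
      using xy by (auto simp: ln_div)
    have "y - x = ln (real (n + 3) / real (n + 2))"
      by (simp add: x_def y_def ln_div)
    also have "\<dots> \<le> real (n + 3) / real (n + 2) - 1"
      by (intro ln_le_minus_one) simp
    also have "\<dots> \<le> 1" by (simp add: field_simps)
    finally have "y - x \<le> 1" .
    then have "(y - x) * (1 / x - 1 / y) \<le> 1 * (1 / x - 1 / y)"
      using xy by (intro mult_right_mono) (auto simp: field_simps)
    moreover have "(y - x) * (1 / x - 1 / y) = y / x - 1 - (1 - x / y)" "(y - x) * (1 / y) = 1 - x / y"
      using xy by (auto simp: field_simps)
    ultimately have "y / x - 1 - (1 - x / y) \<le> 1 / x - 1 / y" and 2: "(y - x) * (1 / y) = 1 - x / y"
      by simp_all
    then have "\<bar>(y - x) * (1 / y) - (ln y - ln x)\<bar> \<le> 1 / x - 1 / y"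
      unfolding 2 using 1 by linarith
    then show "norm ((ln (real (n + 3)) - ln (real (n + 2))) * g n - (ln (ln (real (n + 3))) - ln (ln (real (n + 2))))) \<le> h n - h (Suc n)"
      by (simp add: x_def y_def g_def h_def add.commute)
  qed
  ultimately have "summable (\<lambda>n. (R (Suc n) - R n) * g n + ((ln (real (n + 3)) - ln (real (n + 2))) * g n - (ln (ln (real (n + 3))) - ln (ln (real (n + 2))))))"
    by (rule summable_add)
  also have "(\<lambda>n. (R (Suc n) - R n) * g n + ((ln (real (n + 3)) - ln (real (n + 2))) * g n - (ln (ln (real (n + 3))) - ln (ln (real (n + 2)))))) = (\<lambda>n. E (Suc n) - E n)"
  proof
    fix n
    have *: "Suc (n + 2) = n + 3" by simp
    have "(R (Suc n) - R n) * g n + (ln (real (n + 3)) - ln (real (n + 2))) * g n = (b (n + 3) - b (n + 2)) * g n"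
      by (simp add: R_def algebra_simps eval_nat_numeral)
    also have "\<dots> = a (n + 3) - a (n + 2)"
      using b_Suc[of "n + 2"] a_Suc[of "n + 2"] unfolding * by (simp add: g_def)
    finally show "(R (Suc n) - R n) * g n + ((ln (real (n + 3)) - ln (real (n + 2))) * g n - (ln (ln (real (n + 3))) - ln (ln (real (n + 2))))) = E (Suc n) - E n"
      by (simp add: E_def eval_nat_numeral)
  qed
  finally have "convergent (\<lambda>n. \<Sum>k<n. E (Suc k) - E k)"
    by (simp add: summable_iff_convergent)
  then obtain l where "(\<lambda>n. E n - E 0) \<longlonglongrightarrow> l"
    by (auto simp: convergent_def sum_lessThan_telescope)
  then have "(\<lambda>n. (E n - E 0) + E 0) \<longlonglongrightarrow> l + E 0"
    by (intro tendsto_intros)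
  then have "E \<longlonglongrightarrow> l + E 0" by simp
  then have "(\<lambda>n. a n - ln (ln (real n))) \<longlonglongrightarrow> l + E 0"
    unfolding E_def by (rule LIMSEQ_offset)
  then show ?thesis
    unfolding a_def by blast
qed

section \<open>The zeta function on the real half-line\<close>

text \<open>The mean value theorem for an antiderivative of \<open>z powr - s\<close>. These are the
  two halves of the integral test, in a form that telescopes.\<close>

lemma powr_diff_bounds:
  fixes s :: real
  assumes s: "s > 1" and n: "n \<ge> 1"
  shows "real (Suc n) powr - s \<le> (real n powr (1 - s) - real (Suc n) powr (1 - s)) / (s - 1)"
    and "(real n powr (1 - s) - real (Suc n) powr (1 - s)) / (s - 1) \<le> real n powr - s"
proof -
  have "\<exists>z>real n. z < real (Suc n) \<and> - (real (Suc n) powr (1 - s)) / (s - 1) - - (real n powr (1 - s)) / (s - 1)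
      = (real (Suc n) - real n) * (z powr - s)"
  proof (rule MVT2)
    fix x assume "real n \<le> x"
    then have "x > 0" using n by simp
    then have "((\<lambda>x. - (x powr (1 - s)) / (s - 1)) has_real_derivative - ((1 - s) * x powr (1 - s - 1)) / (s - 1)) (at x)"
      by (intro DERIV_cdivide DERIV_minus has_real_derivative_powr)
    moreover have "- ((1 - s) * x powr (1 - s - 1)) / (s - 1) = x powr - s"
      using s by (simp add: field_simps)
    ultimately show "((\<lambda>x. - (x powr (1 - s)) / (s - 1)) has_real_derivative x powr - s) (at x)"
      by simp
  qed auto
  then obtain z where z: "real n < z" "z < real (Suc n)"
    and eq: "(real n powr (1 - s) - real (Suc n) powr (1 - s)) / (s - 1) = z powr - s"
    by (auto simp: diff_divide_distrib)
  show "real (Suc n) powr - s \<le> (real n powr (1 - s) - real (Suc n) powr (1 - s)) / (s - 1)"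
    unfolding eq using z n s by (intro powr_mono2') auto
  show "(real n powr (1 - s) - real (Suc n) powr (1 - s)) / (s - 1) \<le> real n powr - s"
    unfolding eq using z n s by (intro powr_mono2') auto
qed

text \<open>Telescoping the preceding bounds from 1 gives the lower estimate; the upper one compares
  only the terms from the second onwards, and the first term is the extra 1. Together they show that
  \<open>Z\<close> has a simple pole with residue 1 at \<open>s = 1\<close>.\<close>

lemma zeta_bounds:
  fixes s :: real
  assumes "s > 1"
  defines "Z \<equiv> \<Sum>n. real (Suc n) powr - s"
  shows "summable (\<lambda>n. real (Suc n) powr - s)" "1 / (s - 1) \<le> Z" "Z \<le> 1 + 1 / (s - 1)"
proof -
  define g where "g n = real (Suc n) powr (1 - s) / (s - 1)" for n
  have "g \<longlonglongrightarrow> 0"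
    unfolding g_def using assms by real_asymp
  then have g: "(\<lambda>n. g n - g (Suc n)) sums (1 / (s - 1))"
    using telescope_sums'[of g 0] by (simp add: g_def)
  have sm: "summable (\<lambda>n. real n powr - s)"
    using assms by (simp add: summable_real_powr_iff)
  then show sm1: "summable (\<lambda>n. real (Suc n) powr - s)"
    by (subst summable_Suc_iff)
  then have sm2: "summable (\<lambda>n. real (Suc (Suc n)) powr - s)"
    by (subst summable_Suc_iff)
  have gn: "g n - g (Suc n) = (real (Suc n) powr (1 - s) - real (Suc (Suc n)) powr (1 - s)) / (s - 1)" for n
    by (simp add: g_def diff_divide_distrib)
  show "1 / (s - 1) \<le> Z"
    unfolding Z_def
    by (rule sums_le[OF _ g summable_sums[OF sm1]]) (simp only: gn, rule powr_diff_bounds(2), use assms in auto)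
  have "(\<Sum>n. real (Suc (Suc n)) powr - s) \<le> 1 / (s - 1)"
    by (rule sums_le[OF _ summable_sums[OF sm2] g]) (simp only: gn, rule powr_diff_bounds(1), use assms in auto)
  moreover have "Z = 1 + (\<Sum>n. real (Suc (Suc n)) powr - s)"
    unfolding Z_def using suminf_split_head[OF sm1] by simp
  ultimately show "Z \<le> 1 + 1 / (s - 1)" by simp
qed

text \<open>A finite Euler product, obtained by sieving with one prime at a time. Working with
  \<open>has_sum\<close> allows sums over arbitrary sets of integers to be reindexed and
  subtracted.\<close>

lemma zeta_sieve:
  fixes s Z :: real
  assumes Z: "((\<lambda>n. real n powr - s) has_sum Z) {0<..}"
    and Q: "finite Q" "\<And>q. q \<in> Q \<Longrightarrow> prime q"
  shows "((\<lambda>n. real n powr - s) has_sum (Z * (\<Prod>q\<in>Q. 1 - real q powr - s)))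
           {n. 0 < n \<and> (\<forall>q\<in>Q. \<not> q dvd n)}"
  using Q
proof (induction Q rule: finite_induct)
  case empty
  then show ?case using Z by (simp add: greaterThan_def)
next
  case (insert p Q)
  define S where "S = {n. 0 < n \<and> (\<forall>q\<in>Q. \<not> q dvd n)}"
  define z where "z = Z * (\<Prod>q\<in>Q. 1 - real q powr - s)"
  have p: "prime p" using insert by auto
  then have "p > 0" by (rule prime_gt_0_nat)
  have S: "((\<lambda>n. real n powr - s) has_sum z) S"
    using insert unfolding S_def z_def by auto
  then have "((\<lambda>n. real p powr - s * real n powr - s) has_sum real p powr - s * z) S"
    by (rule has_sum_cmult_right)
  then have pS: "((\<lambda>n. real n powr - s) has_sum real p powr - s * z) ((*) p ` S)"
    using \<open>p > 0\<close> by (subst has_sum_reindex) (auto simp: inj_on_def o_def powr_mult)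
  have dvd: "q dvd p * n \<longleftrightarrow> q dvd n" if "q \<in> Q" for q n
  proof -
    have "coprime q p" using insert that by (metis insertCI p primes_coprime)
    then show ?thesis by (simp add: coprime_dvd_mult_right_iff)
  qed
  \<comment> \<open>\<open>p * S\<close> consists of the multiples of \<open>p\<close> in \<open>S\<close>; removing it multiplies the sum by \<open>1 - p powr - s\<close>.\<close>
  have "(*) p ` S \<subseteq> S"
    using dvd \<open>p > 0\<close> by (auto simp: S_def)
  with S pS have "((\<lambda>n. real n powr - s) has_sum (z - real p powr - s * z)) (S - (*) p ` S)"
    by (rule has_sum_Diff)
  moreover have "S - (*) p ` S = {n. 0 < n \<and> (\<forall>q\<in>insert p Q. \<not> q dvd n)}"
    using dvd \<open>p > 0\<close> by (auto simp: S_def elim!: dvdE)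
  ultimately show ?case
    using insert by (simp add: z_def algebra_simps)
qed

text \<open>After sieving by all primes up to \<open>N\<close>, the number 1 survives and every
  other survivor exceeds \<open>N\<close>. So \<open>Z * P N\<close> lies between 1 and 1 plus a
  tail of the zeta series, and taking logarithms turns this limit into the series.\<close>

lemma ln_zeta_sums:
  fixes s :: real
  assumes s: "s > 1"
  shows "(\<lambda>n. if prime n then - ln (1 - real n powr - s) else 0) sums
           ln (\<Sum>n. real (Suc n) powr - s)"
proof -
  define Z where "Z = (\<Sum>n. real (Suc n) powr - s)"
  define P where "P N = (\<Prod>p | prime p \<and> p \<le> N. 1 - real p powr - s)" for N :: nat
  have "0 < 1 / (s - 1)" using s by simp
  also have "\<dots> \<le> Z" unfolding Z_def by (rule zeta_bounds[OF s])
  finally have "Z > 0" .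
  have sums: "(\<lambda>n. real (Suc n) powr - s) sums Z"
    unfolding Z_def by (intro summable_sums zeta_bounds s)
  then have "((\<lambda>n. real (Suc n) powr - s) has_sum Z) UNIV"
    by (intro sums_nonneg_imp_has_sum) auto
  then have Z: "((\<lambda>n. real n powr - s) has_sum Z) {0<..}"
    using has_sum_reindex[of Suc UNIV "\<lambda>n. real n powr - s" Z]
    by (simp add: o_def greaterThan_0)
  define u where "u N = 1 + (Z - (\<Sum>n<N. real (Suc n) powr - s))" for N
  have lim: "(\<lambda>N. Z * P N) \<longlonglongrightarrow> 1"
  proof (rule tendsto_sandwich[where f = "\<lambda>_. 1" and h = u])
    have "u \<longlonglongrightarrow> 1 + (Z - Z)"
      unfolding u_def using sums by (intro tendsto_intros) (simp add: sums_def)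
    then show "u \<longlonglongrightarrow> 1" by simp
    have S: "((\<lambda>n. real n powr - s) has_sum (Z * P N)) {n. 0 < n \<and> (\<forall>q\<in>{p. prime p \<and> p \<le> N}. \<not> q dvd n)}" for N
      unfolding P_def by (intro zeta_sieve Z) auto
    have "1 \<le> Z * P N \<and> Z * P N \<le> u N" for N
    proof
      let ?S = "{n. 0 < n \<and> (\<forall>q\<in>{p. prime p \<and> p \<le> N}. \<not> q dvd n)}"
      have one: "((\<lambda>n. real n powr - s) has_sum 1) {1::nat}"
        using has_sum_finite[of "{1::nat}" "\<lambda>n. real n powr - s"] by simp
      have "1 \<in> ?S" by (auto dest: prime_gt_1_nat)
      show "1 \<le> Z * P N"
        by (rule has_sum_mono_neutral[OF one S[of N]]) (use \<open>1 \<in> ?S\<close> in auto)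
      have "((\<lambda>n. real n powr - s) has_sum (\<Sum>n\<in>{0<..N}. real n powr - s)) {0<..N}"
        by (rule has_sum_finite) auto
      also have "(\<Sum>n\<in>{0<..N}. real n powr - s) = (\<Sum>n<N. real (Suc n) powr - s)"
        by (rule sum.reindex_bij_witness[of _ Suc "\<lambda>n. n - 1"]) auto
      finally have "((\<lambda>n. real n powr - s) has_sum (Z - (\<Sum>n<N. real (Suc n) powr - s))) ({0<..} - {0<..N})"
        by (intro has_sum_Diff Z) auto
      also have "{0<..} - {0<..N} = {N<..}" by auto
      finally have tail: "((\<lambda>n. real n powr - s) has_sum (Z - (\<Sum>n<N. real (Suc n) powr - s))) {N<..}" .
      show "Z * P N \<le> u N"
      proof (cases "N = 0")
        case True
        have "P 0 = 1" by (auto simp: P_def intro!: prod.neutral)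
        then show ?thesis using True by (simp add: u_def)
      next
        case False
        have "((\<lambda>n. real n powr - s) has_sum (1 + (Z - (\<Sum>n<N. real (Suc n) powr - s)))) ({1} \<union> {N<..})"
          using False by (intro has_sum_Un_disjoint one tail) auto
        moreover have "?S \<subseteq> {1} \<union> {N<..}"
        proof
          fix n assume n: "n \<in> ?S"
          show "n \<in> {1} \<union> {N<..}"
          proof (rule ccontr)
            assume "n \<notin> {1} \<union> {N<..}"
            then have "n \<noteq> 1" "n \<le> N" by auto
            then obtain p where p: "prime p" "p dvd n"
              using prime_factor_nat by blast
            have "p \<le> n" using p n by (auto intro: dvd_imp_le)
            then show False using p n \<open>n \<le> N\<close> by auto
          qed
        qed
        ultimately show ?thesis
          unfolding u_def by (intro has_sum_mono_neutral[OF S[of N]]) auto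
      qed
    qed
    then show "\<forall>\<^sub>F N in sequentially. 1 \<le> Z * P N" "\<forall>\<^sub>F N in sequentially. Z * P N \<le> u N"
      by auto
  qed auto
  have less1: "real p powr - s < 1" if "prime p" for p
    using that s prime_gt_1_nat[of p] by (auto intro: powr_less_one)
  have eq: "(\<Sum>n\<le>N. if prime n then - ln (1 - real n powr - s) else 0) = ln Z - ln (Z * P N)" for N
  proof -
    have "P N > 0" unfolding P_def using less1 by (auto intro: prod_pos)
    then have "ln Z - ln (Z * P N) = - ln (P N)"
      using \<open>Z > 0\<close> by (simp add: ln_mult_pos)
    also have "ln (P N) = (\<Sum>p | prime p \<and> p \<le> N. ln (1 - real p powr - s))"
      unfolding P_def using less1 by (subst ln_prod) (auto dest: less_imp_neq)
    also have "- \<dots> = (\<Sum>p\<in>{p\<in>{..N}. prime p}. - ln (1 - real p powr - s))"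
      by (simp add: sum_negf conj_commute)
    also have "\<dots> = (\<Sum>n\<le>N. if prime n then - ln (1 - real n powr - s) else 0)"
      by (rule sum.inter_filter) auto
    finally show ?thesis by simp
  qed
  have "(\<lambda>N. ln Z - ln (Z * P N)) \<longlonglongrightarrow> ln Z - ln 1"
    by (intro tendsto_intros lim) auto
  then show ?thesis
    unfolding sums_def_le eq Z_def by simp
qed

section \<open>An Abelian theorem for Dirichlet series\<close>

text \<open>The first \<open>N\<close> terms are bounded by a constant \<open>K\<close>, which the
  factor \<open>1 - x\<close> sends to 0. The remaining terms are at most \<open>e / 2\<close> times
  a geometric series, which that factor normalises.\<close>

lemma abel_null:
  fixes r :: "nat \<Rightarrow> real"
  assumes r: "r \<longlonglongrightarrow> 0"
  shows "((\<lambda>x. (1 - x) * (\<Sum>n. r n * x ^ n)) \<longlongrightarrow> 0) (at_left 1)"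
proof (rule tendstoI)
  fix e :: real assume "e > 0"
  then obtain N where N: "\<And>n. n \<ge> N \<Longrightarrow> \<bar>r n\<bar> < e / 2"
    using LIMSEQ_D[OF r, of "e / 2"] by auto
  define K where "K = (\<Sum>n<N. \<bar>r n\<bar>)"
  have "((\<lambda>x. (1 - x) * K) \<longlongrightarrow> (1 - 1) * K) (at_left 1)"
    by (intro tendsto_intros)
  then have "\<forall>\<^sub>F x in at_left 1. (1 - x) * K < e / 2"
    by (rule order_tendstoD) (use \<open>e > 0\<close> in auto)
  moreover have "\<forall>\<^sub>F x in at_left (1::real). x \<in> {0<..<1}"
    by (rule eventually_at_left_real) auto
  ultimately show "\<forall>\<^sub>F x in at_left 1. dist ((1 - x) * (\<Sum>n. r n * x ^ n)) 0 < e"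
  proof eventually_elim
    case (elim x)
    then have x: "0 < x" "x < 1" by auto
    have geo: "(\<lambda>n. x ^ n) sums (1 / (1 - x))"
      using x by (intro geometric_sums) auto
    have fin: "(\<lambda>n. if n \<in> {..<N} then \<bar>r n\<bar> else 0) sums K"
      unfolding K_def by (rule sums_If_finite_set) auto
    have major: "(\<lambda>n. (if n \<in> {..<N} then \<bar>r n\<bar> else 0) + e / 2 * x ^ n) sums (K + e / 2 * (1 / (1 - x)))"
      by (intro sums_add sums_mult fin geo)
    have le: "norm (r n * x ^ n) \<le> (if n \<in> {..<N} then \<bar>r n\<bar> else 0) + e / 2 * x ^ n" for n
    proof (cases "n < N")
      case True
      have "\<bar>r n\<bar> * x ^ n \<le> \<bar>r n\<bar> * 1"
        using x by (intro mult_left_mono power_le_one) auto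
      then show ?thesis using True x \<open>e > 0\<close> by (simp add: abs_mult add_increasing2)
    next
      case False
      then show ?thesis using N[of n] x by (simp add: abs_mult mult_right_mono)
    qed
    have "norm (\<Sum>n. r n * x ^ n) \<le> (\<Sum>n. (if n \<in> {..<N} then \<bar>r n\<bar> else 0) + e / 2 * x ^ n)"
      by (intro norm_suminf_le le sums_summable[OF major])
    also have "\<dots> = K + e / 2 * (1 / (1 - x))"
      using major by (simp add: sums_iff)
    finally have "(1 - x) * norm (\<Sum>n. r n * x ^ n) \<le> (1 - x) * (K + e / 2 * (1 / (1 - x)))"
      using x by (intro mult_left_mono) auto
    also have "\<dots> = (1 - x) * K + e / 2"
      using x by (simp add: field_simps)
    also have "\<dots> < e" using elim by simp
    finally show ?case using x by (simp add: abs_mult)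
  qed
qed

text \<open>With \<open>r n\<close> the error of the partial sum over \<open>k < n\<close>,
  \<open>d n = r (Suc n) - r n\<close> and \<open>r 0 = - l\<close>. Summation by parts then
  expresses the power series through that of \<open>r\<close>, to which \<open>abel_null\<close>
  applies; the index shift causes the division by \<open>x\<close>.\<close>

lemma abel_limit_theorem:
  fixes d :: "nat \<Rightarrow> real"
  assumes d: "d sums l"
  shows "((\<lambda>x. \<Sum>n. d n * x ^ n) \<longlongrightarrow> l) (at_left 1)"
proof -
  define r where "r n = (\<Sum>k<n. d k) - l" for n
  have r: "r \<longlonglongrightarrow> 0"
    using d unfolding r_def sums_def by (simp add: LIM_zero)
  have lim: "((\<lambda>x. (l + (1 - x) * (\<Sum>n. r n * x ^ n)) / x) \<longlongrightarrow> (l + 0) / 1) (at_left 1)"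
    by (intro tendsto_intros abel_null r) auto
  have "\<forall>\<^sub>F x in at_left (1::real). x \<in> {0<..<1}"
    by (rule eventually_at_left_real) auto
  then have "\<forall>\<^sub>F x in at_left 1. (l + (1 - x) * (\<Sum>n. r n * x ^ n)) / x = (\<Sum>n. d n * x ^ n)"
  proof eventually_elim
    case (elim x)
    then have x: "0 < x" "x < 1" by auto
    obtain B where B: "\<And>n. norm (r n) \<le> B"
      using convergent_imp_Bseq[of r] r by (auto simp: convergent_def Bseq_def)
    have sr: "summable (\<lambda>n. r n * x ^ n)"
    proof (rule summable_comparison_test')
      show "summable (\<lambda>n. B * x ^ n)"
        using x by (intro summable_mult summable_geometric) auto
      show "norm (r n * x ^ n) \<le> B * x ^ n" for n
        using B[of n] x by (auto simp: abs_mult intro: mult_right_mono)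
    qed
    have "(\<lambda>n. r (Suc n) * x ^ Suc n) sums ((\<Sum>n. r n * x ^ n) - r 0)"
      using summable_sums[OF sr] by (subst sums_Suc_iff) simp
    then have "(\<lambda>n. r (Suc n) * x ^ Suc n - x * (r n * x ^ n)) sums ((\<Sum>n. r n * x ^ n) - r 0 - x * (\<Sum>n. r n * x ^ n))"
      by (intro sums_diff sums_mult summable_sums sr)
    also have "(\<lambda>n. r (Suc n) * x ^ Suc n - x * (r n * x ^ n)) = (\<lambda>n. x * (d n * x ^ n))"
      by (simp add: r_def algebra_simps)
    also have "(\<Sum>n. r n * x ^ n) - r 0 - x * (\<Sum>n. r n * x ^ n) = l + (1 - x) * (\<Sum>n. r n * x ^ n)"
      by (simp add: r_def algebra_simps)
    finally have "(\<lambda>n. x * (d n * x ^ n)) sums (l + (1 - x) * (\<Sum>n. r n * x ^ n))" .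
    then have "(\<lambda>n. x * (d n * x ^ n) / x) sums ((l + (1 - x) * (\<Sum>n. r n * x ^ n)) / x)"
      by (rule sums_divide)
    then show ?case using x by (simp add: sums_iff)
  qed
  from Lim_transform_eventually[OF lim this] show ?thesis by simp
qed

lemma ln_one_minus_sums:
  assumes "0 < x" "x < (1::real)"
  shows "(\<lambda>n. x ^ Suc n / real (Suc n)) sums (- ln (1 - x))"
proof -
  have "summable (\<lambda>n. x ^ n / real n)"
  proof (rule summable_comparison_test')
    show "summable (\<lambda>n. x ^ n)" using assms by (intro summable_geometric) auto
    show "norm (x ^ n / real n) \<le> x ^ n" for n
      using assms by (cases "n = 0") (auto simp: field_simps)
  qed
  then have "summable (\<lambda>n. x ^ Suc n / real (Suc n))"
    by (subst summable_Suc_iff)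
  moreover have "ln (1 - x) = (\<Sum>n. (-1) ^ n * (1 / real (n + 1)) * ((1 - x) - 1) ^ Suc n)"
    using assms by (intro ln_series) auto
  moreover have "(\<lambda>n. (-1) ^ n * (1 / real (n + 1)) * ((1 - x) - 1) ^ Suc n) = (\<lambda>n. - (x ^ Suc n / real (Suc n)))"
  proof
    fix n
    have "(-1) ^ n * (1 / real (n + 1)) * (- x) ^ Suc n = ((-1) ^ n * (-1) ^ n) * - (x ^ Suc n / real (Suc n))"
      by (subst power_minus) simp
    also have "(-1) ^ n * (-1) ^ n = (1::real)"
      by (simp flip: power_mult_distrib)
    finally show "(-1) ^ n * (1 / real (n + 1)) * ((1 - x) - 1) ^ Suc n = - (x ^ Suc n / real (Suc n))"
      by simp
  qed
  ultimately show ?thesis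
    by (simp add: sums_iff suminf_minus)
qed

text \<open>The blocks used below end at the integer part of \<open>exp m\<close>; this shows that
  the rounding does not affect the limit.\<close>

lemma ln_ln_floor_exp: "(\<lambda>m. ln (ln (real (nat \<lfloor>exp (real m)\<rfloor>))) - ln (real m)) \<longlonglongrightarrow> 0"
proof (rule tendsto_sandwich[where f = "\<lambda>m. ln (ln (exp (real m) - 1)) - ln (real m)" and h = "\<lambda>_. 0"])
  have bounds: "ln (ln (exp (real m) - 1)) \<le> ln (ln (real (nat \<lfloor>exp (real m)\<rfloor>)))"
    "ln (ln (real (nat \<lfloor>exp (real m)\<rfloor>))) \<le> ln (real m)" if "m \<ge> 2" for m :: nat
  proof -
    define N where "N = real (nat \<lfloor>exp (real m)\<rfloor>)"
    have "exp (real m) \<ge> 1 + real m" by (rule exp_ge_add_one_self)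
    then have "1 < exp (real m) - 1" using that by linarith
    moreover have N: "exp (real m) - 1 \<le> N" "N \<le> exp (real m)"
      unfolding N_def using of_nat_floor[of "exp (real m)"] by (linarith, simp)
    ultimately show "ln (ln (exp (real m) - 1)) \<le> ln (ln (real (nat \<lfloor>exp (real m)\<rfloor>)))"
      unfolding N_def[symmetric] using that by (intro ln_mono ln_gt_zero) auto
    have "1 < N" using N \<open>1 < exp (real m) - 1\<close> by linarith
    then have "ln (ln N) \<le> ln (ln (exp (real m)))"
      using N by (intro ln_mono ln_gt_zero) auto
    then show "ln (ln (real (nat \<lfloor>exp (real m)\<rfloor>))) \<le> ln (real m)"
      unfolding N_def by simp
  qed
  show "\<forall>\<^sub>F m in sequentially. ln (ln (exp (real m) - 1)) - ln (real m) \<le> ln (ln (real (nat \<lfloor>exp (real m)\<rfloor>))) - ln (real m)"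
    using eventually_ge_at_top[of 2] by eventually_elim (use bounds(1) in simp)
  show "\<forall>\<^sub>F m in sequentially. ln (ln (real (nat \<lfloor>exp (real m)\<rfloor>))) - ln (real m) \<le> 0"
    using eventually_ge_at_top[of 2] by eventually_elim (use bounds(2) in simp)
  show "(\<lambda>m. ln (ln (exp (real m) - 1)) - ln (real m)) \<longlonglongrightarrow> 0"
    by real_asymp
qed auto

lemma sum_atMost_split:
  assumes "a \<le> (b::nat)"
  shows "sum g {..b} = sum g {..a} + sum g {a<..b}"
proof -
  have "sum g ({..a} \<union> {a<..b}) = sum g {..a} + sum g {a<..b}"
    by (rule sum.union_disjoint) auto
  also have "{..a} \<union> {a<..b} = {..b}" using assms by auto
  finally show ?thesis .
qed

text \<open>Within the block from \<open>exp m\<close> to \<open>exp (m + 1)\<close> the weights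
  \<open>n powr - t\<close> vary by a factor of at most \<open>exp t\<close>. Up to this factor the
  Dirichlet series is therefore a power series in \<open>x = exp (- t)\<close>. Subtracting the
  harmonic coefficients, whose power series is \<open>- ln (1 - x)\<close>, leaves a convergent
  series \<open>d\<close> for Abel's theorem.\<close>

lemma tendsto_dirichlet_log:
  fixes a :: "nat \<Rightarrow> real"
  assumes nonneg: "\<And>n. 0 \<le> a n" and a0: "a 0 = 0" "a 1 = 0"
    and c: "(\<lambda>N. (\<Sum>n\<le>N. a n) - ln (ln (real N))) \<longlonglongrightarrow> c"
    and sm: "\<And>t. t > 0 \<Longrightarrow> summable (\<lambda>n. a n * real n powr - t)"
  shows "((\<lambda>t. (\<Sum>n. a n * real n powr - t) + ln t) \<longlongrightarrow> c - euler_mascheroni) (at_right 0)"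
proof -
  define f where "f m = nat \<lfloor>exp (real m)\<rfloor>" for m :: nat
  define C where "C m = (\<Sum>n\<le>f m. a n)" for m
  define cc where "cc m = C (Suc m) - C m" for m
  define d where "d m = cc m - 1 / real (Suc m)" for m
  define D where "D x = (\<Sum>m. d m * x ^ m)" for x
  have f_ge: "n \<le> f m \<longleftrightarrow> real n \<le> exp (real m)" for n m
    unfolding f_def by (auto simp: le_nat_floor le_nat_iff le_floor_iff)
  have f_mono: "f m \<le> f (Suc m)" for m
    unfolding f_ge using f_ge[of "f m" m] by (meson exp_le_cancel_iff le_SucI of_nat_mono order_refl order_trans)
  have f_top: "filterlim f sequentially sequentially"
    unfolding f_def by real_asymp
  have cc_eq: "cc m = (\<Sum>n\<in>{f m<..f (Suc m)}. a n)" for m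
    unfolding cc_def C_def using sum_atMost_split[OF f_mono[of m], of a] by simp
  \<comment> \<open>The blocks start after \<open>exp 0 = 1\<close>. Since \<open>a\<close> vanishes
    at 0 and 1, they account for the whole sum.\<close>
  have f0: "{..f 0} = {0, 1}"
    by (auto simp: f_def)
  have "C 0 = 0"
    by (simp add: C_def f0 a0[simplified])
  have d_sums: "d sums (c - euler_mascheroni)"
  proof -
    \<comment> \<open>Both \<open>C m\<close> and \<open>harm m\<close> grow like
      \<open>ln m\<close>, with constants \<open>c\<close> and
      \<open>euler_mascheroni\<close>.\<close>
    have "(\<lambda>m. (C m - ln (ln (real (f m)))) + (ln (ln (real (f m))) - ln (real m)) - (harm m - ln (real m)))
        \<longlonglongrightarrow> c + 0 - euler_mascheroni"
      unfolding C_def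
      by (intro tendsto_intros filterlim_compose[OF c f_top] euler_mascheroni_LIMSEQ)
        (use ln_ln_floor_exp in \<open>simp add: f_def\<close>)
    moreover have "(\<Sum>k<m. d k) = C m - harm m" for m
      unfolding d_def cc_def sum_subtractf[of "\<lambda>k. C (Suc k) - C k"] sum_lessThan_telescope
      by (simp add: \<open>C 0 = 0\<close> harm_altdef inverse_eq_divide)
    ultimately show ?thesis unfolding sums_def by simp
  qed
  have bounds: "exp (- t) * D (exp (- t)) - ln (1 - exp (- t)) \<le> (\<Sum>n. a n * real n powr - t)" (is "?l \<le> ?T")
    "(\<Sum>n. a n * real n powr - t) \<le> exp t * (exp (- t) * D (exp (- t)) - ln (1 - exp (- t)))"
    if t: "t > 0" for t
  proof -
    define x where "x = exp (- t)"
    have x: "0 < x" "x < 1" using t by (auto simp: x_def)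
    have "summable (\<lambda>m. d m * x ^ m)"
      using powser_inside[of d 1 x] d_sums x by (simp add: sums_iff)
    then have "(\<lambda>m. x * (d m * x ^ m) + x ^ Suc m / real (Suc m)) sums (x * D x + - ln (1 - x))"
      unfolding D_def by (intro sums_add sums_mult summable_sums ln_one_minus_sums x)
    then have s1: "(\<lambda>m. cc m * x ^ Suc m) sums (x * D x - ln (1 - x))"
      by (simp add: d_def algebra_simps)
    then have "(\<lambda>m. exp t * (cc m * x ^ Suc m)) sums (exp t * (x * D x - ln (1 - x)))"
      by (rule sums_mult)
    then have s2: "(\<lambda>m. cc m * x ^ m) sums (exp t * (x * D x - ln (1 - x)))"
      by (simp add: x_def exp_minus field_simps)
      \<comment> \<open>On the block \<open>exp m < n \<le> exp (m + 1)\<close> the weight \<open>n powr - t\<close> lies between \<open>x ^ Suc m\<close> and \<open>x ^ m\<close>.\<close>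
    have block: "cc m * x ^ Suc m \<le> (\<Sum>n\<in>{f m<..f (Suc m)}. a n * real n powr - t)"
      "(\<Sum>n\<in>{f m<..f (Suc m)}. a n * real n powr - t) \<le> cc m * x ^ m" for m
    proof -
      have n: "real n powr - t \<le> x ^ m" "x ^ Suc m \<le> real n powr - t" if "n \<in> {f m<..f (Suc m)}" for n
      proof -
        have n: "exp (real m) \<le> real n" "real n \<le> exp (real (Suc m))"
          using that f_ge[of n m] f_ge[of n "Suc m"] by auto
        have pow: "x ^ k = exp (real k) powr - t" for k
          by (simp add: x_def powr_def mult.commute flip: exp_of_nat_mult)
        show "real n powr - t \<le> x ^ m" "x ^ Suc m \<le> real n powr - t"
          unfolding pow using n t by (auto intro!: powr_mono2' intro: less_le_trans[OF exp_gt_zero])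
      qed
      show "cc m * x ^ Suc m \<le> (\<Sum>n\<in>{f m<..f (Suc m)}. a n * real n powr - t)"
        unfolding cc_eq sum_distrib_right by (intro sum_mono mult_left_mono n nonneg)
      show "(\<Sum>n\<in>{f m<..f (Suc m)}. a n * real n powr - t) \<le> cc m * x ^ m"
        unfolding cc_eq sum_distrib_right by (intro sum_mono mult_left_mono n nonneg)
    qed
    have split: "(\<Sum>n\<le>f M. a n * real n powr - t) = (\<Sum>m<M. \<Sum>n\<in>{f m<..f (Suc m)}. a n * real n powr - t)" for M
    proof (induction M)
      case 0
      then show ?case by (simp add: f0 a0[simplified])
    next
      case (Suc M)
      have "(\<Sum>n\<le>f (Suc M). a n * real n powr - t) = (\<Sum>n\<le>f M. a n * real n powr - t) + (\<Sum>n\<in>{f M<..f (Suc M)}. a n * real n powr - t)"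
        by (rule sum_atMost_split[OF f_mono])
      then show ?case using Suc by simp
    qed
    have T: "(\<lambda>M. \<Sum>n\<le>f M. a n * real n powr - t) \<longlonglongrightarrow> ?T"
      using summable_sums[OF sm[OF t]] unfolding sums_def_le
      by (rule filterlim_compose[OF _ f_top])
    show "?l \<le> ?T"
      unfolding x_def[symmetric]
      by (rule LIMSEQ_le[OF s1[unfolded sums_def] T]) (intro exI allI impI, unfold split, intro sum_mono block)
    show "?T \<le> exp t * (exp (- t) * D (exp (- t)) - ln (1 - exp (- t)))"
      unfolding x_def[symmetric]
      by (rule LIMSEQ_le[OF T s2[unfolded sums_def]]) (intro exI allI impI, unfold split, intro sum_mono block)
  qed
  have x_lim: "filterlim (\<lambda>t::real. exp (- t)) (at_left 1) (at_right 0)"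
    by real_asymp
  have D_lim: "((\<lambda>t. D (exp (- t))) \<longlongrightarrow> c - euler_mascheroni) (at_right 0)"
    unfolding D_def by (rule filterlim_compose[OF abel_limit_theorem[OF d_sums] x_lim])
  have e_lim: "((\<lambda>t::real. exp (- t)) \<longlongrightarrow> 1) (at_right 0)"
    by real_asymp
  \<comment> \<open>Here \<open>1 - exp (- t)\<close> is asymptotic to \<open>t\<close>. The factor
    \<open>exp t\<close> is harmless: it is 1 plus O(t), against a logarithm of size
    \<open>ln (1 / t)\<close>.\<close>
  have l_lim: "((\<lambda>t::real. ln t - ln (1 - exp (- t))) \<longlongrightarrow> 0) (at_right 0)"
    "((\<lambda>t::real. ln t - exp t * ln (1 - exp (- t))) \<longlongrightarrow> 0) (at_right 0)"
    by real_asymp+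
  have pos: "\<forall>\<^sub>F t in at_right (0::real). t > 0"
    by (simp add: eventually_at_right_less)
  show ?thesis
  proof (rule tendsto_sandwich[where f = "\<lambda>t. exp (- t) * D (exp (- t)) + (ln t - ln (1 - exp (- t)))"
        and h = "\<lambda>t. D (exp (- t)) + (ln t - exp t * ln (1 - exp (- t)))"])
    have "((\<lambda>t. exp (- t) * D (exp (- t)) + (ln t - ln (1 - exp (- t)))) \<longlongrightarrow> 1 * (c - euler_mascheroni) + 0) (at_right 0)"
      by (intro tendsto_add tendsto_mult e_lim D_lim l_lim)
    then show "((\<lambda>t. exp (- t) * D (exp (- t)) + (ln t - ln (1 - exp (- t)))) \<longlongrightarrow> c - euler_mascheroni) (at_right 0)"
      by simp
    have "((\<lambda>t. D (exp (- t)) + (ln t - exp t * ln (1 - exp (- t)))) \<longlongrightarrow> (c - euler_mascheroni) + 0) (at_right 0)"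
      by (intro tendsto_add D_lim l_lim)
    then show "((\<lambda>t. D (exp (- t)) + (ln t - exp t * ln (1 - exp (- t)))) \<longlongrightarrow> c - euler_mascheroni) (at_right 0)"
      by simp
    show "\<forall>\<^sub>F t in at_right 0. exp (- t) * D (exp (- t)) + (ln t - ln (1 - exp (- t))) \<le> (\<Sum>n. a n * real n powr - t) + ln t"
      using pos by eventually_elim (use bounds(1) in force)
    show "\<forall>\<^sub>F t in at_right 0. (\<Sum>n. a n * real n powr - t) + ln t \<le> D (exp (- t)) + (ln t - exp t * ln (1 - exp (- t)))"
      using pos
    proof eventually_elim
      case (elim t)
      have "exp t * (exp (- t) * D (exp (- t)) - ln (1 - exp (- t))) = D (exp (- t)) - exp t * ln (1 - exp (- t))"
        by (simp add: exp_minus field_simps)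
      then show ?case using bounds(2)[OF elim] by simp
    qed
  qed
qed

section \<open>Mertens' third theorem\<close>

lemma minus_ln_one_minus_bounds:
  assumes "0 \<le> z" "z \<le> (1/2::real)"
  shows "z \<le> - ln (1 - z)" "- ln (1 - z) \<le> z + 2 * z\<^sup>2"
proof -
  show "z \<le> - ln (1 - z)"
    using assms ln_le_minus_one[of "1 - z"] by simp
  have "- ln (1 - z) = ln (1 / (1 - z))"
    using assms by (simp add: ln_div)
  also have "\<dots> \<le> 1 / (1 - z) - 1"
    using assms by (intro ln_le_minus_one) simp
  also have "\<dots> = z + z\<^sup>2 / (1 - z)"
    using assms by (simp add: field_simps power2_eq_square)
  also have "z\<^sup>2 / (1 - z) \<le> z\<^sup>2 / (1 / 2)"
    using assms by (intro divide_left_mono) auto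
  finally show "- ln (1 - z) \<le> z + 2 * z\<^sup>2" by simp
qed

text \<open>Both terms equal \<open>t * y\<close> up to second order in \<open>y\<close>, with a
  bound that does not depend on \<open>t\<close>.\<close>

lemma minus_ln_one_minus_scale:
  assumes y: "0 \<le> y" "y \<le> (1/2::real)" and t: "0 \<le> t" "t \<le> 1"
  shows "\<bar>- ln (1 - y) * t - - ln (1 - t * y)\<bar> \<le> 2 * y\<^sup>2"
proof -
  have ty: "0 \<le> t * y" "t * y \<le> y"
    using y t by (auto intro: mult_left_le_one_le)
  have sq: "(t * y)\<^sup>2 \<le> y\<^sup>2" using ty by (intro power_mono)
  have 1: "t * y \<le> - ln (1 - t * y)" "- ln (1 - t * y) \<le> t * y + 2 * (t * y)\<^sup>2"
    using ty y minus_ln_one_minus_bounds[of "t * y"] by auto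
  have "y * t \<le> - ln (1 - y) * t" "- ln (1 - y) * t \<le> (y + 2 * y\<^sup>2) * t"
    by (intro mult_right_mono minus_ln_one_minus_bounds y t)+
  moreover have "(y + 2 * y\<^sup>2) * t \<le> t * y + 2 * y\<^sup>2"
    using t mult_left_le[of t "2 * y\<^sup>2"] by (simp add: algebra_simps)
  ultimately show ?thesis
    using 1 sq mult.commute[of y t] unfolding abs_le_iff by linarith
qed

text \<open>The logarithm of the Euler factor at \<open>s = 1\<close>, extended by 0 to all naturals
  so that it can serve as the coefficients of a Dirichlet series. Its partial sums are minus the
  logarithms of the Mertens products.\<close>

definition euler_log :: "nat \<Rightarrow> real" where
  "euler_log n = (if prime n then - ln (1 - 1 / real n) else 0)"

text \<open>The scaling estimate with \<open>y = 1 / n\<close> and scaling factor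
  \<open>n powr - t\<close>. The majorant is independent of \<open>t\<close>, as dominated
  convergence for \<open>t\<close> tending to 0 requires.\<close>

lemma euler_log_diff_le:
  assumes "t \<ge> 0"
  shows "\<bar>euler_log n * real n powr - t - (if prime n then - ln (1 - real n powr - (1 + t)) else 0)\<bar> \<le> 2 * real n powr - 2"
proof (cases "prime n")
  case True
  then have n: "n \<ge> 2" by (rule prime_ge_2_nat)
  have "\<bar>- ln (1 - 1 / real n) * real n powr - t - - ln (1 - real n powr - t * (1 / real n))\<bar> \<le> 2 * (1 / real n)\<^sup>2"
    using n assms ge_one_powr_ge_zero[of "real n" t]
    by (intro minus_ln_one_minus_scale) (auto simp: powr_minus field_simps)
  moreover have "real n powr - (1 + t) = real n powr - t * (1 / real n)"
    using n powr_add[of "real n" "- t" "- 1"] by (simp add: powr_minus field_simps)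
  moreover have "real n powr - 2 = (1 / real n)\<^sup>2"
    using n by (simp add: powr_minus power_divide field_simps)
  ultimately show ?thesis using True by (simp add: euler_log_def)
qed (simp add: euler_log_def)

lemma summable_powr_minus_2: "summable (\<lambda>n. 2 * real n powr - 2)"
  by (intro summable_mult, subst summable_real_powr_iff) simp

lemma euler_log_nonneg: "euler_log n \<ge> 0"
proof (cases "prime n")
  case True
  then have n: "n \<ge> 2" by (rule prime_ge_2_nat)
  then show ?thesis
    using minus_ln_one_minus_bounds(1)[of "1 / real n"] True
    by (simp add: euler_log_def order_trans[of 0 "1 / real n"])
qed (simp add: euler_log_def)

lemma summable_euler_log:
  assumes t: "t > 0"
  shows "summable (\<lambda>n. euler_log n * real n powr - t)"
proof -
  have "summable (\<lambda>n. euler_log n * real n powr - t - (if prime n then - ln (1 - real n powr - (1 + t)) else 0))"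
    by (rule summable_comparison_test'[OF summable_powr_minus_2])
      (use euler_log_diff_le t in auto)
  moreover have "summable (\<lambda>n. if prime n then - ln (1 - real n powr - (1 + t)) else 0)"
    using ln_zeta_sums[of "1 + t"] t by (auto simp: sums_iff)
  ultimately have "summable (\<lambda>n. (euler_log n * real n powr - t - (if prime n then - ln (1 - real n powr - (1 + t)) else 0)) + (if prime n then - ln (1 - real n powr - (1 + t)) else 0))"
    by (rule summable_add)
  then show ?thesis by simp
qed

text \<open>The weighted terms are not those of \<open>ln (Z t)\<close>, but the differences vanish
  termwise at \<open>t = 0\<close> and are dominated, so Tannery's theorem removes them. What is
  left is \<open>ln (t * Z t)\<close>, and \<open>t * Z t\<close> lies between 1 and
  \<open>1 + t\<close>.\<close>

lemma euler_log_series_tendsto: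
  "((\<lambda>t. (\<Sum>n. euler_log n * real n powr - t) + ln t) \<longlongrightarrow> 0) (at_right 0)"
proof -
  define F where "F t n = (if prime n then - ln (1 - real n powr - (1 + t)) else 0)" for t n
  define Z where "Z t = (\<Sum>n. real (Suc n) powr - (1 + t))" for t :: real
  have pos: "\<forall>\<^sub>F t in at_right (0::real). t > 0"
    by (simp add: eventually_at_right_less)
  have "((\<lambda>t. \<Sum>n. euler_log n * real n powr - t - F t n) \<longlongrightarrow> (\<Sum>n. 0)) (at_right 0)"
  proof (rule tannerys_theorem[THEN conjunct2, THEN conjunct2])
    show "((\<lambda>t. euler_log n * real n powr - t - F t n) \<longlongrightarrow> 0) (at_right 0)" for n
    proof (cases "prime n")
      case True
      then have n: "n \<ge> 2" by (rule prime_ge_2_nat)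
      then have "((\<lambda>t. - ln (1 - 1 / real n) * real n powr - t - - ln (1 - real n powr - (1 + t))) \<longlongrightarrow>
          - ln (1 - 1 / real n) * real n powr - 0 - - ln (1 - real n powr - (1 + 0))) (at_right 0)"
        by (intro tendsto_intros) (auto simp: powr_minus field_simps)
      then show ?thesis
        using True n by (simp add: euler_log_def F_def powr_minus field_simps)
    qed (simp add: euler_log_def F_def)
    have "\<forall>\<^sub>F x in sequentially \<times>\<^sub>F at_right (0::real). True \<and> snd x > 0"
      by (rule eventually_prodI) (use pos in auto)
    then show "\<forall>\<^sub>F (n, t) in sequentially \<times>\<^sub>F at_right 0. norm (euler_log n * real n powr - t - F t n) \<le> 2 * real n powr - 2"
    proof eventually_elim
      case (elim x)
      then show ?case
        using euler_log_diff_le[of "snd x" "fst x"] by (simp add: F_def case_prod_beta)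
    qed
  qed (use summable_powr_minus_2 in auto)
  moreover have "((\<lambda>t. ln (t * Z t)) \<longlongrightarrow> 0) (at_right 0)"
  proof (rule tendsto_sandwich[where f = "\<lambda>_. 0" and h = "\<lambda>t. ln (1 + t)"])
    have Z: "1 \<le> t * Z t" "t * Z t \<le> 1 + t" if "t > 0" for t
    proof -
      have "t * (1 / t) \<le> t * Z t" "t * Z t \<le> t * (1 + 1 / t)"
        using zeta_bounds(2,3)[of "1 + t"] that unfolding Z_def by (intro mult_left_mono; simp)+
      moreover have "t * (1 / t) = 1" "t * (1 + 1 / t) = 1 + t"
        using that by (simp_all add: distrib_left)
      ultimately show "1 \<le> t * Z t" "t * Z t \<le> 1 + t"
        by simp_all
    qed
    show "\<forall>\<^sub>F t in at_right 0. 0 \<le> ln (t * Z t)"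
      using pos by eventually_elim (use Z in auto)
    show "\<forall>\<^sub>F t in at_right 0. ln (t * Z t) \<le> ln (1 + t)"
      using pos
    proof eventually_elim
      case (elim t)
      then have "0 < t * Z t" using Z(1)[OF elim] by linarith
      then show ?case using Z(2)[OF elim] by (intro ln_mono)
    qed
    show "((\<lambda>t::real. ln (1 + t)) \<longlongrightarrow> 0) (at_right 0)"
      by real_asymp
  qed auto
  ultimately have lim: "((\<lambda>t. (\<Sum>n. euler_log n * real n powr - t - F t n) + ln (t * Z t)) \<longlongrightarrow> 0 + 0) (at_right 0)"
    by (intro tendsto_add) auto
  have "\<forall>\<^sub>F t in at_right 0. (\<Sum>n. euler_log n * real n powr - t - F t n) + ln (t * Z t) =
      (\<Sum>n. euler_log n * real n powr - t) + ln t"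
    using pos
  proof eventually_elim
    case (elim t)
    have F: "F t sums ln (Z t)"
      using ln_zeta_sums[of "1 + t"] elim unfolding F_def[abs_def] Z_def by simp
    have "0 < 1 / t" using elim by simp
    also have "1 / t \<le> Z t"
      using zeta_bounds(2)[of "1 + t"] elim by (simp add: Z_def)
    finally have "ln (t * Z t) = ln t + ln (Z t)"
      using elim by (simp add: ln_mult_pos)
    moreover have "(\<Sum>n. euler_log n * real n powr - t - F t n) = (\<Sum>n. euler_log n * real n powr - t) - ln (Z t)"
      using suminf_diff[OF summable_euler_log[OF elim] sums_summable[OF F]] F by (simp add: sums_iff)
    ultimately show ?case by simp
  qed
  from Lim_transform_eventually[OF lim this] show ?thesis by simp
qed

text \<open>Mertens' second theorem and the summable remainders \<open>r\<close> show that some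
  limit \<open>M + B\<close> exists; its value comes from the Dirichlet series near 0.\<close>

lemma sum_euler_log_tendsto:
  "(\<lambda>N. (\<Sum>n\<le>N. euler_log n) - ln (ln (real N))) \<longlonglongrightarrow> euler_mascheroni"
proof -
  obtain M where M: "(\<lambda>N. (\<Sum>p | prime p \<and> p \<le> N. 1 / real p) - ln (ln (real N))) \<longlonglongrightarrow> M"
    using mertens_second by blast
  define r where "r n = euler_log n - (if prime n then 1 / real n else 0)" for n
  have "summable r"
  proof (rule summable_comparison_test'[OF summable_powr_minus_2])
    fix n :: nat
    show "norm (r n) \<le> 2 * real n powr - 2"
    proof (cases "prime n")
      case True
      then have n: "n \<ge> 2" by (rule prime_ge_2_nat)
      moreover have "real n powr - 2 = (1 / real n)\<^sup>2"
        using n by (simp add: powr_minus power_divide field_simps)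
      ultimately show ?thesis
        using minus_ln_one_minus_bounds[of "1 / real n"] True
        by (simp add: r_def euler_log_def)
    qed (simp add: r_def euler_log_def)
  qed
  then obtain B where "r sums B" by (auto simp: summable_def)
  then have "(\<lambda>N. ((\<Sum>p | prime p \<and> p \<le> N. 1 / real p) - ln (ln (real N))) + (\<Sum>n\<le>N. r n)) \<longlonglongrightarrow> M + B"
    unfolding sums_def_le by (intro tendsto_add M)
  moreover have "(\<Sum>n\<le>N. r n) = (\<Sum>n\<le>N. euler_log n) - (\<Sum>p | prime p \<and> p \<le> N. 1 / real p)" for N
  proof -
    have "(\<Sum>n\<le>N. if prime n then 1 / real n else 0) = (\<Sum>p\<in>{p\<in>{..N}. prime p}. 1 / real p)"
      by (rule sum.inter_filter[symmetric]) auto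
    then show ?thesis by (simp add: r_def sum_subtractf conj_commute)
  qed
  ultimately have c: "(\<lambda>N. (\<Sum>n\<le>N. euler_log n) - ln (ln (real N))) \<longlonglongrightarrow> M + B"
    by simp
  have "((\<lambda>t. (\<Sum>n. euler_log n * real n powr - t) + ln t) \<longlongrightarrow> M + B - euler_mascheroni) (at_right 0)"
    by (rule tendsto_dirichlet_log[OF euler_log_nonneg _ _ c summable_euler_log])
      (auto simp: euler_log_def)
  \<comment> \<open>The same function of \<open>t\<close> has been given two limits at 0, so they
    coincide.\<close>
  then have "M + B - euler_mascheroni = 0"
    by (rule tendsto_unique[rotated]) (use euler_log_series_tendsto in auto)
  then show ?thesis using c by simp
qed

theorem mertens_third:
  "(\<lambda>N. (\<Prod>p | prime p \<and> p \<le> N. 1 - 1 / real p) * ln (real N)) \<longlonglongrightarrow> exp (- euler_mascheroni)"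
proof -
  have lim: "(\<lambda>N. exp (- ((\<Sum>n\<le>N. euler_log n) - ln (ln (real N))))) \<longlonglongrightarrow> exp (- euler_mascheroni)"
    by (intro tendsto_intros sum_euler_log_tendsto)
  have "\<forall>\<^sub>F N in sequentially. exp (- ((\<Sum>n\<le>N. euler_log n) - ln (ln (real N)))) =
      (\<Prod>p | prime p \<and> p \<le> N. 1 - 1 / real p) * ln (real N)"
    using eventually_ge_at_top[of 2]
  proof eventually_elim
    case (elim N)
    have "(\<Sum>n\<le>N. euler_log n) = (\<Sum>p\<in>{p\<in>{..N}. prime p}. - ln (1 - 1 / real p))"
      unfolding euler_log_def by (rule sum.inter_filter[symmetric]) auto
    then have "exp (- (\<Sum>n\<le>N. euler_log n)) = (\<Prod>p | prime p \<and> p \<le> N. exp (ln (1 - 1 / real p)))"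
      by (simp add: sum_negf exp_sum conj_commute)
    also have "\<dots> = (\<Prod>p | prime p \<and> p \<le> N. 1 - 1 / real p)"
      by (intro prod.cong refl) (auto dest: prime_gt_1_nat)
    finally show ?case
      using elim by (simp add: exp_diff exp_minus field_simps)
  qed
  from Lim_transform_eventually[OF lim this] show ?thesis .
qed

section \<open>The prime counting function as an integral\<close>

text \<open>Beyond some \<open>T\<close> the difference \<open>f - C * g\<close> is at most
  \<open>e / 2 * g\<close> in absolute value. The integral up to \<open>T\<close> is a constant,
  negligible because the integral of \<open>g\<close> diverges.\<close>

lemma integral_asymp_ratio:
  fixes f g :: "real \<Rightarrow> real"
  assumes f: "\<And>x. f integrable_on {a..x}" and g: "\<And>x. g integrable_on {a..x}"
    and pos: "\<And>t. t \<ge> a \<Longrightarrow> g t > 0"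
    and top: "filterlim (\<lambda>x. integral {a..x} g) at_top at_top"
    and lim: "((\<lambda>t. f t / g t) \<longlongrightarrow> C) at_top"
  shows "((\<lambda>x. integral {a..x} f / integral {a..x} g) \<longlongrightarrow> C) at_top"
proof (rule tendstoI)
  fix e :: real assume e: "e > 0"
  define h where "h t = f t - C * g t" for t
  have h: "h integrable_on {a..x}" for x
    unfolding h_def by (intro integrable_diff integrable_on_mult_right f g)
  have "\<forall>\<^sub>F t in at_top. dist (f t / g t) C < e / 2"
    using lim e by (intro tendstoD) auto
  then obtain T0 where T0: "\<And>t. t \<ge> T0 \<Longrightarrow> dist (f t / g t) C < e / 2"
    by (auto simp: eventually_at_top_linorder)
  define T where "T = max a T0"
  have hT: "\<bar>h t\<bar> \<le> e / 2 * g t" if "t \<ge> T" for t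
  proof -
    have "g t > 0" using pos that by (simp add: T_def)
    moreover from this have "h t = (f t / g t - C) * g t"
      by (simp add: h_def left_diff_distrib)
    then have "\<bar>h t\<bar> = \<bar>f t / g t - C\<bar> * g t"
      using \<open>g t > 0\<close> by (simp add: abs_mult)
    ultimately show ?thesis
      using T0[of t] that by (simp add: T_def dist_real_def)
  qed
  define K where "K = \<bar>integral {a..T} h\<bar>"
  \<comment> \<open>This threshold makes the integral positive and forces
    \<open>K < e / 2 * G\<close> below.\<close>
  have "\<forall>\<^sub>F x in at_top. integral {a..x} g > 2 * K / e + 1"
    using top by (rule filterlim_at_top_dense[THEN iffD1, rule_format])
  moreover have "\<forall>\<^sub>F x in at_top. x \<ge> T" by (rule eventually_ge_at_top)
  ultimately show "\<forall>\<^sub>F x in at_top. dist (integral {a..x} f / integral {a..x} g) C < e"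
  proof eventually_elim
    case (elim x)
    define G where "G = integral {a..x} g"
    have aT: "a \<le> T" by (simp add: T_def)
    have "K \<ge> 0" by (simp add: K_def)
    then have "2 * K / e \<ge> 0" using e by simp
    then have G: "G > 0" "2 * K / e < G"
      using elim unfolding G_def[symmetric] by linarith+
    then have K: "K < e / 2 * G"
      using e by (simp add: field_simps)
    have sub: "h integrable_on {T..x}" "g integrable_on {T..x}"
      by (rule integrable_on_subinterval[OF h[of x]] integrable_on_subinterval[OF g[of x]]; use aT in force)+
    have nn: "0 \<le> integral {a..T} g"
      using pos by (intro integral_nonneg g) (auto intro: less_imp_le)
    have split: "integral {a..T} h + integral {T..x} h = integral {a..x} h"
      "integral {a..T} g + integral {T..x} g = integral {a..x} g"
      using aT elim by (intro Henstock_Kurzweil_Integration.integral_combine h g; simp)+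
    have "\<bar>integral {T..x} h\<bar> \<le> integral {T..x} (\<lambda>t. e / 2 * g t)"
      using integral_norm_bound_integral[of h "{T..x}" "\<lambda>t. e / 2 * g t"] sub hT
      by (auto intro: integrable_on_mult_right)
    also have "\<dots> = e / 2 * integral {T..x} g" by simp
    also have "\<dots> \<le> e / 2 * G"
      unfolding G_def using split nn e by (intro mult_left_mono) auto
    finally have "\<bar>integral {a..x} h\<bar> < e * G"
      using split(1) K unfolding K_def by linarith
    moreover have "integral {a..x} h = integral {a..x} f - C * G"
      unfolding h_def G_def using f g by (subst integral_diff) (auto intro: integrable_on_mult_right)
    ultimately have "\<bar>integral {a..x} f - C * G\<bar> < e * G" by simp
    then have "\<bar>integral {a..x} f - C * G\<bar> / G < e"
      using G by (simp add: field_simps)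
    moreover have "integral {a..x} f / G - C = (integral {a..x} f - C * G) / G"
      using G by (simp add: diff_divide_distrib)
    then have "\<bar>integral {a..x} f - C * G\<bar> / G = \<bar>integral {a..x} f / G - C\<bar>"
      using G by simp
    ultimately show ?case by (simp add: dist_real_def G_def)
  qed
qed

lemma one_div_ln_integrable: "(\<lambda>t::real. 1 / ln t) integrable_on {2..x}"
  by (intro integrable_continuous_real continuous_intros) auto

text \<open>The integrand is decreasing, so its value at \<open>x\<close> bounds it from below on
  the whole interval.\<close>

lemma li_at_top: "filterlim li at_top at_top"
proof (rule filterlim_at_top_mono)
  show "filterlim (\<lambda>x::real. (x - 2) / ln x) at_top at_top" by real_asymp
  show "\<forall>\<^sub>F x in at_top. (x - 2) / ln x \<le> li x"
    using eventually_ge_at_top[of 2]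
  proof eventually_elim
    case (elim x)
    have "integral {2..x} (\<lambda>t. 1 / ln x) \<le> li x"
      unfolding li_def
    proof (intro integral_le one_div_ln_integrable)
      fix t assume "t \<in> {2..x}"
      then show "1 / ln x \<le> 1 / ln t"
        by (intro divide_left_mono mult_pos_pos) auto
    qed auto
    then show ?case using elim by simp
  qed
qed

section \<open>The Mertens product over primes up to \<open>sqrt t\<close> as an integrand\<close>

definition mertens_prod :: "real \<Rightarrow> real" where
  "mertens_prod t = (\<Prod>p | prime p \<and> p \<le> nat \<lfloor>sqrt t\<rfloor>. 1 - 1 / real p)"

text \<open>Enlarging the set of primes multiplies by factors from \<open>{0..1}\<close>.
  Monotonicity yields integrability without locating the jumps.\<close>

lemma mertens_prod_mono:
  assumes "s \<le> t"
  shows "mertens_prod t \<le> mertens_prod s"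
proof -
  define P where "P t = {p. prime p \<and> p \<le> nat \<lfloor>sqrt t\<rfloor>}" for t
  have "nat \<lfloor>sqrt s\<rfloor> \<le> nat \<lfloor>sqrt t\<rfloor>"
    using assms by (intro nat_mono floor_mono) simp
  then have "P s \<subseteq> P t" by (auto simp: P_def)
  moreover have "finite (P t)" by (simp add: P_def)
  ultimately have "mertens_prod t = (\<Prod>p\<in>P t - P s. 1 - 1 / real p) * mertens_prod s"
    unfolding mertens_prod_def P_def[symmetric] by (rule prod.subset_diff)
  moreover have factor: "0 \<le> 1 - 1 / real p \<and> 1 - 1 / real p \<le> 1" if "prime p" for p
    using prime_gt_0_nat[OF that] by simp
  have "(\<Prod>p\<in>P t - P s. 1 - 1 / real p) \<le> 1" "0 \<le> (\<Prod>p\<in>P t - P s. 1 - 1 / real p)"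
    using factor by (auto simp: P_def intro!: prod_le_1 prod_nonneg)
  moreover have "0 \<le> mertens_prod s"
    unfolding mertens_prod_def using factor by (auto intro!: prod_nonneg)
  ultimately show ?thesis by (simp add: mult_left_le_one_le)
qed

lemma mertens_prod_integrable: "mertens_prod integrable_on {a..b}"
proof -
  have "(\<lambda>t. - mertens_prod t) integrable_on {a..b}"
    by (intro integrable_on_mono_on) (auto simp: mono_on_def mertens_prod_mono)
  then show ?thesis by (simp add: integrable_neg_iff)
qed

text \<open>The factor 2 is the limit of \<open>ln t\<close> divided by the logarithm of the integer
  part of \<open>sqrt t\<close>.\<close>

lemma mertens_prod_asymp:
  "((\<lambda>t. mertens_prod t / (1 / ln t)) \<longlongrightarrow> 2 * exp (- euler_mascheroni)) at_top"
proof -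
  have top: "filterlim (\<lambda>t::real. nat \<lfloor>sqrt t\<rfloor>) sequentially at_top"
    by real_asymp
  have ratio: "((\<lambda>t. ln t / ln (real (nat \<lfloor>sqrt t\<rfloor>))) \<longlongrightarrow> 2) at_top"
    by real_asymp
  have lim: "((\<lambda>t. mertens_prod t * ln (real (nat \<lfloor>sqrt t\<rfloor>)) * (ln t / ln (real (nat \<lfloor>sqrt t\<rfloor>))))
      \<longlongrightarrow> exp (- euler_mascheroni) * 2) at_top"
    unfolding mertens_prod_def by (intro tendsto_mult ratio filterlim_compose[OF mertens_third top])
  have "\<forall>\<^sub>F t in at_top. nat \<lfloor>sqrt t\<rfloor> \<ge> 2"
    using top by (simp add: filterlim_at_top)
  then have "\<forall>\<^sub>F t in at_top. mertens_prod t * ln (real (nat \<lfloor>sqrt t\<rfloor>)) * (ln t / ln (real (nat \<lfloor>sqrt t\<rfloor>))) = mertens_prod t / (1 / ln t)"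
  proof eventually_elim
    case (elim t)
    then have "real (nat \<lfloor>sqrt t\<rfloor>) > 1" by linarith
    then have "ln (real (nat \<lfloor>sqrt t\<rfloor>)) > 0" by (rule ln_gt_zero)
    then show ?case by simp
  qed
  from Lim_transform_eventually[OF lim this] show ?thesis by (simp add: mult.commute)
qed

section \<open>The enumeration of the primes and \<open>pitilde\<close> as an integral\<close>

lemma pr_1: "pr 1 = 2"
proof -
  have "pr 1 = (LEAST p::nat. prime p)" by (simp add: pr_def enumerate_0)
  also have "\<dots> = 2"
    by (rule Least_equality) (auto dest: prime_ge_2_nat)
  finally show ?thesis .
qed

lemma pr_prime: "prime (pr k)"
  using enumerate_in_set[OF primes_infinite] by (auto simp: pr_def)

text \<open>The bound on \<open>j\<close> excludes \<open>pr 0\<close>, which equals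
  \<open>pr 1\<close> by truncated subtraction.\<close>

lemma pr_less: "1 \<le> j \<Longrightarrow> j < k \<Longrightarrow> pr j < pr k"
  unfolding pr_def by (rule enumerate_mono) (auto simp: primes_infinite)

lemma pr_ge: "k - 1 \<le> pr k"
  unfolding pr_def by (rule le_enumerate) (rule primes_infinite)

lemma primes_le_eq_image_pr:
  assumes "1 \<le> k" "pr k \<le> m" "m < pr (k + 1)"
  shows "{p. prime p \<and> p \<le> m} = pr ` {1..k}"
proof (intro equalityI subsetI)
  fix p assume p: "p \<in> {p. prime p \<and> p \<le> m}"
  then obtain n where "enumerate {q. prime q} n = p"
    using enumerate_Ex[OF primes_infinite, of p] by auto
  then have n: "p = pr (n + 1)" by (simp add: pr_def)
  have "n + 1 < k + 1"
  proof (rule ccontr)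
    assume "\<not> n + 1 < k + 1"
    then have "pr (k + 1) \<le> pr (n + 1)"
      using pr_less[of "k + 1" "n + 1"] by (cases "n = k") auto
    then show False using p n assms by simp
  qed
  then show "p \<in> pr ` {1..k}" using n by auto
next
  fix p assume "p \<in> pr ` {1..k}"
  then obtain j where j: "1 \<le> j" "j \<le> k" "p = pr j" by auto
  then have "p \<le> pr k" using pr_less[of j k] by (cases "j = k") auto
  then show "p \<in> {p. prime p \<and> p \<le> m}" using j assms pr_prime by auto
qed

lemma mertens_prod_eq:
  assumes k: "1 \<le> k" and t: "real (pr k)^2 \<le> t" "t < real (pr (k + 1))^2"
  shows "mertens_prod t = (\<Prod>i=1..k. 1 - 1 / real (pr i))"
proof -
  have "real (pr k) \<le> sqrt t" "sqrt t < real (pr (k + 1))"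
    using t by (auto intro: real_le_rsqrt real_less_lsqrt)
  then have "pr k \<le> nat \<lfloor>sqrt t\<rfloor>" "nat \<lfloor>sqrt t\<rfloor> < pr (k + 1)"
    by (linarith, linarith)
  then have "mertens_prod t = (\<Prod>p\<in>pr ` {1..k}. 1 - 1 / real p)"
    unfolding mertens_prod_def using primes_le_eq_image_pr[OF k] by simp
  also have "\<dots> = (\<Prod>i=1..k. 1 - 1 / real (pr i))"
  proof (subst prod.reindex)
    show "inj_on pr {1..k}"
      by (rule inj_onI) (metis atLeastAtMost_iff less_irrefl linorder_neqE_nat pr_less)
  qed simp
  finally show ?thesis .
qed

text \<open>On this interval the integrand is constant, and \<open>ell k\<close> cancels against the
  factor in \<open>pitilde_j k\<close>. The right endpoint is allowed so that full intervals can be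
  joined.\<close>

lemma mertens_prod_has_integral:
  assumes k: "1 \<le> k" and x: "real (pr k)^2 \<le> x" "x \<le> real (pr (k + 1))^2"
  shows "(mertens_prod has_integral ((x - real (pr k)^2) / ell k * pitilde_j k)) {real (pr k)^2..x}"
proof -
  let ?W = "\<Prod>i=1..k. 1 - 1 / real (pr i)"
  have "((\<lambda>_. ?W) has_integral (x - real (pr k)^2) * ?W) {real (pr k)^2..x}"
    using has_integral_const_real[of ?W "real (pr k)^2" x] x by simp
  \<comment> \<open>If \<open>x\<close> is the next prime square, the integrand already has its next
    value there; a single point does not change the integral.\<close>
  then have "(mertens_prod has_integral (x - real (pr k)^2) * ?W) {real (pr k)^2..x}"
    by (rule has_integral_spike_finite[of "{x}", rotated 2])
      (use mertens_prod_eq[OF k] x in auto)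
  moreover have "ell k > 0"
    using pr_less[of k "k + 1"] k by (simp add: ell_def power_strict_mono)
  ultimately show ?thesis by (simp add: pitilde_j_def)
qed

lemma mertens_prod_has_integral_sum:
  assumes "1 \<le> k"
  shows "(mertens_prod has_integral (\<Sum>j=1..k-1. pitilde_j j)) {4..real (pr k)^2}"
  using assms
proof (induction k rule: dec_induct)
  case base
  then show ?case using pr_1 has_integral_refl(2)[of mertens_prod 4] by simp
next
  case (step k)
  have less: "pr k < pr (k + 1)" using pr_less[of k "k + 1"] step by simp
  then have le: "real (pr k)^2 \<le> real (pr (k + 1))^2" by (intro power_mono) auto
  have "2 \<le> pr k" using pr_prime prime_ge_2_nat by blast
  then have "2^2 \<le> real (pr k)^2" by (intro power_mono) auto
  then have four: "4 \<le> real (pr k)^2" by simp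
  have "ell k > 0"
    using less by (simp add: ell_def power_strict_mono)
  then have "(mertens_prod has_integral pitilde_j k) {real (pr k)^2..real (pr (k + 1))^2}"
    using mertens_prod_has_integral[of k "real (pr (k + 1))^2"] step le less by (simp add: ell_def)
  from has_integral_combine[OF four le step.IH this]
  have "(mertens_prod has_integral (\<Sum>j=1..k-1. pitilde_j j) + pitilde_j k) {4..real (pr (k + 1))^2}" .
  moreover have "(\<Sum>j=1..k-1. pitilde_j j) + pitilde_j k = (\<Sum>j=1..k. pitilde_j j)"
    using step by (cases k) auto
  ultimately show ?case by simp
qed

text \<open>The description is meaningful: existence comes from a least index, uniqueness from the
  squares of the primes being increasing.\<close>

lemma kidx:
  assumes "x \<ge> 4"
  shows "1 \<le> kidx x \<and> real (pr (kidx x))^2 \<le> x \<and> x < real (pr (kidx x + 1))^2"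
proof -
  define k where "k = (LEAST k. x < real (pr (k + 1))^2)"
  define m where "m = nat \<lceil>x\<rceil> + 1"
  have "x < real m" unfolding m_def by linarith
  also have "real m \<le> real (pr (m + 1))" using pr_ge[of "m + 1"] by simp
  also have "\<dots> \<le> real (pr (m + 1))^2"
    using prime_gt_0_nat[OF pr_prime[of "m + 1"]] by (simp add: power2_eq_square)
  finally have ex: "x < real (pr (m + 1))^2" .
  then have up: "x < real (pr (k + 1))^2" unfolding k_def by (rule LeastI)
  have k1: "1 \<le> k"
  proof (rule ccontr)
    assume "\<not> 1 \<le> k"
    then have "x < 4" using up pr_1 by (simp add: not_le)
    then show False using assms by simp
  qed
  \<comment> \<open>Minimality is used at \<open>k - 1\<close>, where \<open>1 <= k\<close> ensures
    that the successor is \<open>k\<close> itself.\<close>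
  then have lo: "real (pr k)^2 \<le> x"
    using not_less_Least[of "k - 1" "\<lambda>k. x < real (pr (k + 1))^2", folded k_def] by simp
  have mono: "real (pr (i + 1))^2 \<le> real (pr j)^2" if "1 \<le> i" "i < j" for i j
    using that pr_less[of "i + 1" j] by (cases "j = i + 1") (auto intro!: power_mono)
  have "kidx x = k"
    unfolding kidx_def
  proof (rule the_equality)
    fix i assume i: "1 \<le> i \<and> real (pr i)^2 \<le> x \<and> x < real (pr (i + 1))^2"
    then have "\<not> i < k" "\<not> k < i"
      using mono[of i k] mono[of k i] k1 lo up by linarith+
    then show "i = k" by simp
  qed (use k1 lo up in auto)
  then show ?thesis using k1 lo up by simp
qed

lemma pitilde_has_integral:
  assumes "x \<ge> 4"
  shows "(mertens_prod has_integral pitilde x) {4..x}"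
proof -
  define k where "k = kidx x"
  have k: "1 \<le> k" "real (pr k)^2 \<le> x" "x < real (pr (k + 1))^2"
    using kidx[OF assms] unfolding k_def by auto
  have "2 \<le> pr k" using pr_prime prime_ge_2_nat by blast
  then have "2^2 \<le> real (pr k)^2" by (intro power_mono) auto
  then have four: "4 \<le> real (pr k)^2" by simp
  show ?thesis
    unfolding pitilde_def k_def[symmetric] Let_def
    by (rule has_integral_combine[OF four k(2) mertens_prod_has_integral_sum[OF k(1)]
          mertens_prod_has_integral]) (use k in auto)
qed

theorem theorem3p4:
  shows "pitilde \<sim>[at_top] (\<lambda>x. 2 * exp (- euler_mascheroni) * li x)"
proof -
  define C :: real where "C = 2 * exp (- euler_mascheroni)"
  \<comment> \<open>\<open>li\<close> starts at 2 but the integral for \<open>pitilde\<close> at 4.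
    The difference is the constant \<open>K\<close>, and \<open>K / li x\<close> tends to 0.\<close>
  define K where "K = integral {2..4} mertens_prod"
  have "((\<lambda>x. integral {2..x} mertens_prod / integral {2..x} (\<lambda>t. 1 / ln t)) \<longlongrightarrow> C) at_top"
    unfolding C_def using li_at_top unfolding li_def[abs_def]
    by (intro integral_asymp_ratio mertens_prod_integrable one_div_ln_integrable mertens_prod_asymp) auto
  then have "((\<lambda>x. integral {2..x} mertens_prod / li x - K / li x) \<longlongrightarrow> C - 0) at_top"
    unfolding li_def[symmetric]
    by (intro tendsto_diff tendsto_divide_0[OF tendsto_const] filterlim_at_top_imp_at_infinity li_at_top)
  moreover have "\<forall>\<^sub>F x in at_top. integral {2..x} mertens_prod / li x - K / li x = pitilde x / li x"
    using eventually_ge_at_top[of 4]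
  proof eventually_elim
    case (elim x)
    have "integral {2..4} mertens_prod + integral {4..x} mertens_prod = integral {2..x} mertens_prod"
      using elim by (intro Henstock_Kurzweil_Integration.integral_combine mertens_prod_integrable) auto
    moreover have "integral {4..x} mertens_prod = pitilde x"
      using pitilde_has_integral[OF elim] by (rule integral_unique)
    ultimately show ?case by (simp add: K_def flip: diff_divide_distrib)
  qed
  ultimately have "((\<lambda>x. pitilde x / li x) \<longlongrightarrow> C) at_top"
    using Lim_transform_eventually by fastforce
  then have "pitilde \<sim>[at_top] (\<lambda>x. C * li x)"
    by (intro asymp_equivI'_const) (auto simp: C_def)
  then show ?thesis by (simp add: C_def)
qed

end
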